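(* For the $2$-user symmetric linear deterministic Z interference channel with unidirectional, rate-limited transmitter cooperation of capacity $C$ from transmitter $2$ to transmitter $1$ (any nonnegative integers $m\ge1$, $n$, $C$), $$\mathcal{C}^{\text{perfect}}=\mathcal{C}^{\text{strong}}=\mathcal{C}^{\text{weak}},$$ where these are the capacity regions under the perfect, strong and weak secrecy constraints at the receivers, respectively.
   Context: Model: let $q=\max\{m,n\}$ and let $\mathbf{D}$ be the $q\times q$ downshift matrix over $\mathbb{F}_2$ (entries $d_{j',j''}=1$ if $2\le j'=j''+1\le q$, and $0$ otherwise). At each channel use, transmitter $i$ sends $\mathbf{x}_i\in\mathbb{F}_2^q$, and the outputs are $\mathbf{y}_1=\mathbf{D}^{q-m}\mathbf{x}_1\oplus\mathbf{D}^{q-n}\mathbf{x}_2$ and $\mathbf{y}_2=\mathbf{D}^{q-m}\mathbf{x}_2$, where $\oplus$ is componentwise addition mod $2$. Transmitter $i$ has a message $W_i$ uniform on $\{1,\dots,2^{NR_i}\}$ ($N$ = block length). Transmitter $2$ can send to transmitter $1$, over a noiseless secure link, at most $C$ bits per channel use; transmitter $2$'s signal depends only on $W_2$ (and possibly its own randomness), while transmitter $1$'s signal at each time is a function of $W_1$, the bits received so far over the cooperative link (causality), and possibly locally generated random bits. Receiver $i$ decodes $W_i$ from $\mathbf{y}_i^N$. A rate pair is achievable under a given secrecy notion if there exist such codes with error probability $\to0$ as $N\to\infty$ and, for $i\ne j$: (perfect) $I(W_i;\mathbf{y}_j^N)=0$; (strong) $I(W_i;\mathbf{y}_j^N)\to0$;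 (weak) $\frac1N I(W_i;\mathbf{y}_j^N)\to0$, as $N\to\infty$. Each capacity region is the closure of the corresponding set of achievable rate pairs. *)

theory Defs
  imports "HOL-Probability.Probability"
begin

text \<open>Vectors in F_2^q are represented as functions nat => bool, where only the
indices 0..q-1 are meaningful (0-based; entry j corresponds to row j+1 of the paper).
trunc_vec q x forgets everything outside the index range.\<close>

definition trunc_vec :: "nat \<Rightarrow> (nat \<Rightarrow> bool) \<Rightarrow> (nat \<Rightarrow> bool)" where
  "trunc_vec q x = (\<lambda>j. j < q \<and> x j)"

text \<open>Multiplication by the q x q downshift matrix D (d_{j',j''} = 1 iff j' = j''+1):
(D x)_j = x_{j-1} for j >= 1 (0-based), and 0 in the top entry.\<close>

definition downshift :: "nat \<Rightarrow> (nat \<Rightarrow> bool) \<Rightarrow> (nat \<Rightarrow> bool)" where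
  "downshift q x = (\<lambda>j. 0 < j \<and> j < q \<and> x (j - 1))"

definition downshift_pow :: "nat \<Rightarrow> nat \<Rightarrow> (nat \<Rightarrow> bool) \<Rightarrow> (nat \<Rightarrow> bool)" where
  "downshift_pow q k x = (downshift q ^^ k) (trunc_vec q x)"

definition vadd :: "nat \<Rightarrow> (nat \<Rightarrow> bool) \<Rightarrow> (nat \<Rightarrow> bool) \<Rightarrow> (nat \<Rightarrow> bool)" where
  "vadd q x y = (\<lambda>j. j < q \<and> (x j \<noteq> y j))"

definition qdim :: "nat \<Rightarrow> nat \<Rightarrow> nat" where
  "qdim m n = max m n"

definition chan_y1 :: "nat \<Rightarrow> nat \<Rightarrow> (nat \<Rightarrow> bool) \<Rightarrow> (nat \<Rightarrow> bool) \<Rightarrow> (nat \<Rightarrow> bool)" where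
  "chan_y1 m n x1 x2 = vadd (qdim m n)
      (downshift_pow (qdim m n) (qdim m n - m) x1) (downshift_pow (qdim m n) (qdim m n - n) x2)"

definition chan_y2 :: "nat \<Rightarrow> nat \<Rightarrow> (nat \<Rightarrow> bool) \<Rightarrow> (nat \<Rightarrow> bool)" where
  "chan_y2 m n x2 = trunc_vec (qdim m n) (downshift_pow (qdim m n) (qdim m n - m) x2)"

text \<open>A block-length-N code.  Messages are w1 in {0..<M1}, w2 in {0..<M2};
transmitter i has a private source of randomness r_i drawn from rnd_i (independent
of everything else).  At time t (0-based, t < N):
  - transmitter 2 sends link w2 r2 t in {0..<2^C} (i.e. C bits) over the cooperative link
    and channel input enc2 w2 r2 t;
  - transmitter 1 sends enc1 w1 r1 v t where v is the sequence of link symbols,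
    with enc1 depending only on the link symbols received before time t (causality);
  - receiver i decodes with dec_i from the whole output sequence y_i^N.\<close>

record code =
  rnd1 :: "nat pmf"
  rnd2 :: "nat pmf"
  enc1 :: "nat \<Rightarrow> nat \<Rightarrow> (nat \<Rightarrow> nat) \<Rightarrow> nat \<Rightarrow> (nat \<Rightarrow> bool)"
  enc2 :: "nat \<Rightarrow> nat \<Rightarrow> nat \<Rightarrow> (nat \<Rightarrow> bool)"
  coop :: "nat \<Rightarrow> nat \<Rightarrow> nat \<Rightarrow> nat"
  dec1 :: "(nat \<Rightarrow> nat \<Rightarrow> bool) \<Rightarrow> nat"
  dec2 :: "(nat \<Rightarrow> nat \<Rightarrow> bool) \<Rightarrow> nat"

definition valid_code :: "nat \<Rightarrow> code \<Rightarrow> bool" where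
  "valid_code C c \<longleftrightarrow>
     (\<forall>w r t. coop c w r t < 2 ^ C) \<and>
     (\<forall>w r v v' t. (\<forall>s<t. v s = v' s) \<longrightarrow> enc1 c w r v t = enc1 c w r v' t)"

definition code_space :: "nat \<Rightarrow> nat \<Rightarrow> code \<Rightarrow> (nat \<times> nat \<times> nat \<times> nat) pmf" where
  "code_space M1 M2 c =
     bind_pmf (pmf_of_set {0..<M1}) (\<lambda>w1.
     bind_pmf (pmf_of_set {0..<M2}) (\<lambda>w2.
     bind_pmf (rnd1 c) (\<lambda>r1.
     bind_pmf (rnd2 c) (\<lambda>r2. return_pmf (w1, w2, r1, r2)))))"

definition msgW1 :: "nat \<times> nat \<times> nat \<times> nat \<Rightarrow> nat" where
  "msgW1 \<omega> = fst \<omega>"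

definition msgW2 :: "nat \<times> nat \<times> nat \<times> nat \<Rightarrow> nat" where
  "msgW2 \<omega> = fst (snd \<omega>)"

definition out1 :: "nat \<Rightarrow> nat \<Rightarrow> nat \<Rightarrow> code \<Rightarrow> nat \<times> nat \<times> nat \<times> nat \<Rightarrow> (nat \<Rightarrow> nat \<Rightarrow> bool)" where
  "out1 m n N c \<omega> = (case \<omega> of (w1, w2, r1, r2) \<Rightarrow>
     (\<lambda>t. if t < N then chan_y1 m n (enc1 c w1 r1 (coop c w2 r2) t) (enc2 c w2 r2 t)
          else (\<lambda>_. False)))"

definition out2 :: "nat \<Rightarrow> nat \<Rightarrow> nat \<Rightarrow> code \<Rightarrow> nat \<times> nat \<times> nat \<times> nat \<Rightarrow> (nat \<Rightarrow> nat \<Rightarrow> bool)" where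
  "out2 m n N c \<omega> = (case \<omega> of (w1, w2, r1, r2) \<Rightarrow>
     (\<lambda>t. if t < N then chan_y2 m n (enc2 c w2 r2 t) else (\<lambda>_. False)))"

definition error_prob :: "nat \<Rightarrow> nat \<Rightarrow> nat \<Rightarrow> nat \<Rightarrow> nat \<Rightarrow> code \<Rightarrow> real" where
  "error_prob m n N M1 M2 c = measure_pmf.prob (code_space M1 M2 c)
     {\<omega>. dec1 c (out1 m n N c \<omega>) \<noteq> msgW1 \<omega> \<or> dec2 c (out2 m n N c \<omega>) \<noteq> msgW2 \<omega>}"

definition mutual_info :: "'o pmf \<Rightarrow> ('o \<Rightarrow> 'a) \<Rightarrow> ('o \<Rightarrow> 'b) \<Rightarrow> real" where
  "mutual_info p X Y =
     (let J = map_pmf (\<lambda>\<omega>. (X \<omega>, Y \<omega>)) p; PX = map_pmf X p; PY = map_pmf Y p in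
      \<Sum>(a, b) \<in> set_pmf J. pmf J (a, b) * log 2 (pmf J (a, b) / (pmf PX a * pmf PY b)))"

text \<open>Message set size {1..2^{N R}} (rounded down), indexed here as {0..<M}.\<close>
definition msg_size :: "nat \<Rightarrow> real \<Rightarrow> nat" where
  "msg_size N R = nat \<lfloor>2 powr (real N * R)\<rfloor>"

datatype secrecy = Perfect | Strong | Weak

definition leak12 :: "nat \<Rightarrow> nat \<Rightarrow> nat \<Rightarrow> real \<Rightarrow> real \<Rightarrow> code \<Rightarrow> real" where
  "leak12 m n N R1 R2 c =
     mutual_info (code_space (msg_size N R1) (msg_size N R2) c) msgW1 (out2 m n N c)"

definition leak21 :: "nat \<Rightarrow> nat \<Rightarrow> nat \<Rightarrow> real \<Rightarrow> real \<Rightarrow> code \<Rightarrow> real" where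
  "leak21 m n N R1 R2 c =
     mutual_info (code_space (msg_size N R1) (msg_size N R2) c) msgW2 (out1 m n N c)"

definition secrecy_ok :: "secrecy \<Rightarrow> nat \<Rightarrow> nat \<Rightarrow> real \<Rightarrow> real \<Rightarrow> (nat \<Rightarrow> code) \<Rightarrow> bool" where
  "secrecy_ok s m n R1 R2 cs = (case s of
      Perfect \<Rightarrow> (\<forall>N. leak12 m n N R1 R2 (cs N) = 0 \<and> leak21 m n N R1 R2 (cs N) = 0)
    | Strong \<Rightarrow> ((\<lambda>N. leak12 m n N R1 R2 (cs N)) \<longlonglongrightarrow> 0) \<and>
                ((\<lambda>N. leak21 m n N R1 R2 (cs N)) \<longlonglongrightarrow> 0)
    | Weak \<Rightarrow> ((\<lambda>N. leak12 m n N R1 R2 (cs N) / real N) \<longlonglongrightarrow> 0) \<and>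
              ((\<lambda>N. leak21 m n N R1 R2 (cs N) / real N) \<longlonglongrightarrow> 0))"

definition achievable :: "secrecy \<Rightarrow> nat \<Rightarrow> nat \<Rightarrow> nat \<Rightarrow> real \<times> real \<Rightarrow> bool" where
  "achievable s m n C R \<longleftrightarrow> (case R of (R1, R2) \<Rightarrow>
     0 \<le> R1 \<and> 0 \<le> R2 \<and>
     (\<exists>cs :: nat \<Rightarrow> code.
        (\<forall>N. valid_code C (cs N)) \<and>
        ((\<lambda>N. error_prob m n N (msg_size N R1) (msg_size N R2) (cs N)) \<longlonglongrightarrow> 0) \<and>
        secrecy_ok s m n R1 R2 cs))"

definition capacity_region :: "secrecy \<Rightarrow> nat \<Rightarrow> nat \<Rightarrow> nat \<Rightarrow> (real \<times> real) set" where
  "capacity_region s m n C = closure {R. achievable s m n C R}"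

end

theory Submission
  imports Defs
begin

text \<open>All three regions equal the polygon \<open>R1 \<le> m\<close>, \<open>R2 \<le> (m - (n - m)\<^sup>+)\<^sup>+\<close>,
  \<open>R1 + R2 \<le> m + (m - n)\<^sup>+ + C\<close>. Perfect secrecy implies strong and strong implies weak, so it
  suffices to confine the weak region to the polygon and to reach its points with perfect secrecy.

  The outer bound is an entropy computation in which the only consequence of the cooperation limit
  is that receiver 1, even knowing \<open>W1\<close>, the strategy of transmitter 1 and the link sequence, misses
  all but \<open>N C\<close> bits of the interference; hence \<open>H(Y1 | W1) \<ge> H(X2) - N C\<close>.

  For the inner bound, transmitter 2 announces up to \<open>C\<close> of its interfering bits one time step ahead,
  and transmitter 1 cancels them; further interfering bits are hidden by uniform jamming bits
  of transmitter 1 acting as a one-time pad, each of which costs one bit of \<open>R1\<close>. Message 1 is always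
  perfectly secret because \<open>y2\<close> does not depend on transmitter 1.\<close>

section \<open>Entropy of finitely supported random variables\<close>

text \<open>Written as an expectation over the sample space, so that entropies of several variables
  combine under one integral and can be compared pointwise.\<close>

definition ent :: "'o pmf \<Rightarrow> ('o \<Rightarrow> 'a) \<Rightarrow> real" where
  "ent p X = measure_pmf.expectation p (\<lambda>\<omega>. - log 2 (pmf (map_pmf X p) (X \<omega>)))"

lemma expectation_mono_finite:
  fixes f g :: "'o \<Rightarrow> real"
  assumes "finite (set_pmf p)" "\<And>\<omega>. \<omega> \<in> set_pmf p \<Longrightarrow> f \<omega> \<le> g \<omega>"
  shows "measure_pmf.expectation p f \<le> measure_pmf.expectation p g"
  using assms by (intro integral_mono_AE integrable_measure_pmf_finite) (auto simp: AE_measure_pmf_iff)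

lemma pmf_map_pos:
  assumes "\<omega> \<in> set_pmf p"
  shows "0 < pmf (map_pmf X p) (X \<omega>)"
  using assms by (simp add: pmf_positive)

text \<open>Integrating \<open>ln x \<le> x - 1\<close> at the ratio of \<open>q\<close> to the law
  of \<open>X\<close>. The cardinality bound, submodularity and Fano's inequality below are all
  instances, each for its own weight \<open>q\<close> of total mass at most 1.\<close>

lemma gibbs:
  assumes fin: "finite (set_pmf p)"
    and pos: "\<And>\<omega>. \<omega> \<in> set_pmf p \<Longrightarrow> 0 < q (X \<omega>)"
    and sub: "(\<Sum>x\<in>X ` set_pmf p. q x) \<le> 1"
  shows "ent p X \<le> measure_pmf.expectation p (\<lambda>\<omega>. - log 2 (q (X \<omega>)))"
proof -
  let ?P = "map_pmf X p"
  let ?E = "measure_pmf.expectation p"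
  note int = integrable_measure_pmf_finite[OF fin]
  have "?E (\<lambda>\<omega>. q (X \<omega>) / pmf ?P (X \<omega>)) = measure_pmf.expectation ?P (\<lambda>x. q x / pmf ?P x)"
    by simp
  also have "\<dots> = (\<Sum>x\<in>X ` set_pmf p. (q x / pmf ?P x) * pmf ?P x)"
    using fin by (intro integral_measure_pmf_real) auto
  also have "\<dots> = (\<Sum>x\<in>X ` set_pmf p. q x)"
    using pmf_map_pos[of _ p X] by (intro sum.cong) fastforce+
  finally have ratio: "?E (\<lambda>\<omega>. q (X \<omega>) / pmf ?P (X \<omega>)) \<le> 1" using sub by simp
  have "ent p X - ?E (\<lambda>\<omega>. - log 2 (q (X \<omega>))) = ?E (\<lambda>\<omega>. - log 2 (pmf ?P (X \<omega>)) - - log 2 (q (X \<omega>)))"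
    unfolding ent_def by (rule Bochner_Integration.integral_diff[symmetric]) (rule int)+
  also have "\<dots> \<le> ?E (\<lambda>\<omega>. (q (X \<omega>) / pmf ?P (X \<omega>) - 1) / ln 2)"
  proof (rule expectation_mono_finite[OF fin])
    fix \<omega> assume w: "\<omega> \<in> set_pmf p"
    have "ln (q (X \<omega>) / pmf ?P (X \<omega>)) \<le> q (X \<omega>) / pmf ?P (X \<omega>) - 1"
      using pos[OF w] pmf_map_pos[OF w, of X] by (intro ln_le_minus_one) simp
    then have "ln (q (X \<omega>)) - ln (pmf ?P (X \<omega>)) \<le> q (X \<omega>) / pmf ?P (X \<omega>) - 1"
      using pos[OF w] pmf_map_pos[OF w, of X] by (simp add: ln_div)
    then have "(ln (q (X \<omega>)) - ln (pmf ?P (X \<omega>))) / ln 2 \<le> (q (X \<omega>) / pmf ?P (X \<omega>) - 1) / ln 2"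
      by (intro divide_right_mono) auto
    then show "- log 2 (pmf ?P (X \<omega>)) - - log 2 (q (X \<omega>)) \<le> (q (X \<omega>) / pmf ?P (X \<omega>) - 1) / ln 2"
      by (simp add: log_def diff_divide_distrib)
  qed
  also have "\<dots> = (?E (\<lambda>\<omega>. q (X \<omega>) / pmf ?P (X \<omega>)) - 1) / ln 2"
    by (simp add: Bochner_Integration.integral_diff[OF int int])
  also have "\<dots> \<le> 0" using ratio by (simp add: divide_le_0_iff)
  finally show ?thesis by simp
qed

text \<open>Gibbs' inequality against the uniform weight on \<open>S\<close>.\<close>

lemma ent_le_log_card:
  assumes "finite (set_pmf p)" "finite S" "X ` set_pmf p \<subseteq> S"
  shows "ent p X \<le> log 2 (card S)"
proof -
  have "S \<noteq> {}" using assms(3) set_pmf_not_empty[of p] by auto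
  then have c: "0 < real (card S)" using assms(2) by (simp add: card_gt_0_iff)
  have "real (card (X ` set_pmf p)) \<le> card S" using card_mono[OF assms(2,3)] by simp
  then have "ent p X \<le> measure_pmf.expectation p (\<lambda>\<omega>. - log 2 (1 / card S))"
    using c by (intro gibbs[OF assms(1)]) (auto simp: field_simps)
  also have "\<dots> = log 2 (card S)" using c by (simp add: log_divide)
  finally show ?thesis .
qed

lemma ent_le_card_bits:
  assumes "finite (set_pmf p)" "finite S" "X ` set_pmf p \<subseteq> Pow S"
  shows "ent p X \<le> card S"
  using ent_le_log_card[OF assms(1) _ assms(3)] assms(2) by (simp add: card_Pow log_nat_power)

lemma pmf_map_le:
  assumes "\<And>\<omega>'. \<omega>' \<in> set_pmf p \<Longrightarrow> X \<omega>' = x \<Longrightarrow> Y \<omega>' = y"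
  shows "pmf (map_pmf X p) x \<le> pmf (map_pmf Y p) y"
proof -
  have "measure p (X -` {x}) = measure p (X -` {x} \<inter> set_pmf p)" by (simp add: measure_Int_set_pmf)
  also have "\<dots> \<le> measure p (Y -` {y})" using assms by (intro measure_pmf.finite_measure_mono) auto
  finally show ?thesis by (simp add: pmf_map)
qed

text \<open>If \<open>X\<close> determines \<open>Y\<close> on the support, each fibre of
  \<open>X\<close> lies in a fibre of \<open>Y\<close>, so the inequality already holds between the
  integrands.\<close>

lemma ent_mono:
  assumes "finite (set_pmf p)"
    and "\<And>\<omega> \<omega>'. \<omega> \<in> set_pmf p \<Longrightarrow> \<omega>' \<in> set_pmf p \<Longrightarrow> X \<omega>' = X \<omega> \<Longrightarrow> Y \<omega>' = Y \<omega>"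
  shows "ent p Y \<le> ent p X"
  unfolding ent_def
proof (rule expectation_mono_finite[OF assms(1)])
  fix \<omega> assume w: "\<omega> \<in> set_pmf p"
  have "pmf (map_pmf X p) (X \<omega>) \<le> pmf (map_pmf Y p) (Y \<omega>)"
    using assms(2)[OF w] by (intro pmf_map_le) auto
  then show "- log 2 (pmf (map_pmf Y p) (Y \<omega>)) \<le> - log 2 (pmf (map_pmf X p) (X \<omega>))"
    using pmf_map_pos[OF w, of X] by simp
qed

lemma sum_pmf_pair_le:
  assumes "finite A"
  shows "(\<Sum>x\<in>A. pmf (map_pmf (\<lambda>\<omega>. (X \<omega>, Z \<omega>)) p) (x, z)) \<le> pmf (map_pmf Z p) z"
proof -
  let ?P = "map_pmf (\<lambda>\<omega>. (X \<omega>, Z \<omega>)) p"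
  have "(\<Sum>x\<in>A. pmf ?P (x, z)) = (\<Sum>u\<in>A \<times> {z}. pmf ?P u)"
    by (simp add: sum.cartesian_product')
  also have "\<dots> = measure ?P (A \<times> {z})"
    using assms by (intro measure_measure_pmf_finite[symmetric]) simp
  also have "\<dots> = measure p ((\<lambda>\<omega>. (X \<omega>, Z \<omega>)) -` (A \<times> {z}))" by simp
  also have "\<dots> \<le> measure p (Z -` {z})" by (intro measure_pmf.finite_measure_mono) auto
  finally show ?thesis by (simp add: pmf_map)
qed

text \<open>This is nonnegativity of the conditional mutual information of \<open>X\<close> and
  \<open>Y\<close> given \<open>Z\<close>. The weight \<open>q\<close> is the law with the same
  \<open>(X, Z)\<close> and \<open>(Y, Z)\<close> marginals under which \<open>X\<close> and
  \<open>Y\<close> are conditionally independent.\<close>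

lemma ent_submodular:
  assumes fin: "finite (set_pmf p)"
  shows "ent p (\<lambda>\<omega>. (X \<omega>, Y \<omega>, Z \<omega>)) + ent p Z
    \<le> ent p (\<lambda>\<omega>. (X \<omega>, Z \<omega>)) + ent p (\<lambda>\<omega>. (Y \<omega>, Z \<omega>))"
proof -
  let ?xz = "pmf (map_pmf (\<lambda>\<omega>. (X \<omega>, Z \<omega>)) p)"
  let ?yz = "pmf (map_pmf (\<lambda>\<omega>. (Y \<omega>, Z \<omega>)) p)"
  let ?z = "pmf (map_pmf Z p)"
  let ?E = "measure_pmf.expectation p"
  define q where "q = (\<lambda>(x, y, z). ?xz (x, z) * ?yz (y, z) / ?z z)"
  note int = integrable_measure_pmf_finite[OF fin]
  note pos = pmf_map_pos[of _ p "\<lambda>\<omega>. (X \<omega>, Z \<omega>)"] pmf_map_pos[of _ p "\<lambda>\<omega>. (Y \<omega>, Z \<omega>)"]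
    pmf_map_pos[of _ p Z]
  have q0: "0 \<le> q u" for u by (auto simp: q_def split: prod.split)
  let ?A = "X ` set_pmf p" and ?B = "Y ` set_pmf p" and ?C = "Z ` set_pmf p"
  \<comment> \<open>Passing to the full product of the ranges only enlarges the sum and lets it
    factor for each fixed \<open>z\<close>.\<close>
  have "(\<Sum>u\<in>(\<lambda>\<omega>. (X \<omega>, Y \<omega>, Z \<omega>)) ` set_pmf p. q u) \<le> (\<Sum>u\<in>?A \<times> ?B \<times> ?C. q u)"
    using fin q0 by (intro sum_mono2) auto
  also have "\<dots> = (\<Sum>x\<in>?A. \<Sum>y\<in>?B. \<Sum>z\<in>?C. q (x, y, z))"
    by (simp add: sum.cartesian_product)
  also have "\<dots> = (\<Sum>x\<in>?A. \<Sum>z\<in>?C. \<Sum>y\<in>?B. q (x, y, z))"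
    by (intro sum.cong refl) (rule sum.swap)
  also have "\<dots> = (\<Sum>z\<in>?C. \<Sum>x\<in>?A. \<Sum>y\<in>?B. q (x, y, z))"
    by (rule sum.swap)
  also have "\<dots> = (\<Sum>z\<in>?C. (\<Sum>x\<in>?A. ?xz (x, z)) * (\<Sum>y\<in>?B. ?yz (y, z)) / ?z z)"
    by (simp add: q_def sum_product sum_divide_distrib)
  also have "\<dots> \<le> (\<Sum>z\<in>?C. ?z z * ?z z / ?z z)"
    using fin by (intro sum_mono divide_right_mono mult_mono sum_pmf_pair_le sum_nonneg) auto
  also have "\<dots> = (\<Sum>z\<in>?C. ?z z)" by (intro sum.cong) auto
  also have "\<dots> = 1" using fin by (intro sum_pmf_eq_1) auto
  finally have sub: "(\<Sum>u\<in>(\<lambda>\<omega>. (X \<omega>, Y \<omega>, Z \<omega>)) ` set_pmf p. q u) \<le> 1" .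
  have "ent p (\<lambda>\<omega>. (X \<omega>, Y \<omega>, Z \<omega>)) \<le> ?E (\<lambda>\<omega>. - log 2 (q (X \<omega>, Y \<omega>, Z \<omega>)))"
    using pos by (intro gibbs[OF fin _ sub]) (auto simp: q_def)
  also have "\<dots> = ?E (\<lambda>\<omega>. (- log 2 (?xz (X \<omega>, Z \<omega>)) + - log 2 (?yz (Y \<omega>, Z \<omega>))) - - log 2 (?z (Z \<omega>)))"
    using pos by (intro integral_cong_AE)
      (auto simp: AE_measure_pmf_iff q_def log_mult log_divide less_imp_neq[THEN not_sym])
  also have "\<dots> = ent p (\<lambda>\<omega>. (X \<omega>, Z \<omega>)) + ent p (\<lambda>\<omega>. (Y \<omega>, Z \<omega>)) - ent p Z"
    unfolding ent_def by (subst Bochner_Integration.integral_diff[OF int int],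
      subst Bochner_Integration.integral_add[OF int int]) (rule refl)
  finally show ?thesis by simp
qed

lemma ent_const: "ent p (\<lambda>_. c) = 0"
  by (simp add: ent_def)

lemma ent_subadditive:
  assumes fin: "finite (set_pmf p)"
  shows "ent p (\<lambda>\<omega>. (X \<omega>, Y \<omega>)) \<le> ent p X + ent p Y"
proof -
  have "ent p (\<lambda>\<omega>. (X \<omega>, Y \<omega>)) \<le> ent p (\<lambda>\<omega>. (X \<omega>, Y \<omega>, ()))" by (rule ent_mono[OF fin]) auto
  moreover have "ent p (\<lambda>\<omega>. (X \<omega>, ())) \<le> ent p X" by (rule ent_mono[OF fin]) auto
  moreover have "ent p (\<lambda>\<omega>. (Y \<omega>, ())) \<le> ent p Y" by (rule ent_mono[OF fin]) auto
  ultimately show ?thesis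
    using ent_submodular[OF fin, of X Y "\<lambda>_. ()"] ent_const[of p "()"] by simp
qed

lemma ent_indep:
  assumes fin: "finite (set_pmf p)"
    and ind: "map_pmf (\<lambda>\<omega>. (X \<omega>, Y \<omega>)) p = pair_pmf (map_pmf X p) (map_pmf Y p)"
  shows "ent p (\<lambda>\<omega>. (X \<omega>, Y \<omega>)) = ent p X + ent p Y"
proof -
  let ?E = "measure_pmf.expectation p"
  note int = integrable_measure_pmf_finite[OF fin]
  have "ent p (\<lambda>\<omega>. (X \<omega>, Y \<omega>)) = ?E (\<lambda>\<omega>. - log 2 (pmf (map_pmf X p) (X \<omega>)) + - log 2 (pmf (map_pmf Y p) (Y \<omega>)))"
    unfolding ent_def ind
    using pmf_map_pos[of _ p X] pmf_map_pos[of _ p Y]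
    by (intro integral_cong_AE)
      (auto simp: AE_measure_pmf_iff pmf_pair log_mult less_imp_neq[THEN not_sym])
  also have "\<dots> = ent p X + ent p Y"
    unfolding ent_def by (rule Bochner_Integration.integral_add[OF int int])
  finally show ?thesis .
qed

lemma ent_uniform:
  assumes "map_pmf X p = pmf_of_set S" "finite S" "S \<noteq> {}"
  shows "ent p X = log 2 (card S)"
proof -
  have "X ` set_pmf p = S" using arg_cong[OF assms(1), of set_pmf] assms(2,3) by simp
  then have "ent p X = measure_pmf.expectation p (\<lambda>\<omega>. log 2 (card S))"
    unfolding ent_def assms(1) using assms(2,3)
    by (intro integral_cong_AE) (auto simp: AE_measure_pmf_iff log_divide card_gt_0_iff)
  then show ?thesis by simp
qed

text \<open>The one bit stands in for the binary entropy of the error event.\<close>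

lemma fano:
  assumes fin: "finite (set_pmf p)" and S: "finite S" "W ` set_pmf p \<subseteq> S"
  shows "ent p (\<lambda>\<omega>. (W \<omega>, Y \<omega>))
    \<le> ent p Y + 1 + measure_pmf.prob p {\<omega>. dec (Y \<omega>) \<noteq> W \<omega>} * log 2 (card S)"
proof -
  let ?E = "measure_pmf.expectation p"
  let ?M = "real (card S)"
  let ?Y = "pmf (map_pmf Y p)"
  \<comment> \<open>Half of the mass sits on the decoded value and half is spread over
    \<open>S\<close>, so the surprisal is one bit after correct decoding and
    \<open>1 + log 2 ?M\<close> bits otherwise.\<close>
  define k where "k = (\<lambda>y w. if w = dec y then 1/2 else 1/(2 * ?M))"
  define q where "q = (\<lambda>(w, y). ?Y y * k y w)"
  note int = integrable_measure_pmf_finite[OF fin]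
  have "S \<noteq> {}" using S(2) set_pmf_not_empty[of p] by auto
  then have M: "0 < ?M" using S(1) by (simp add: card_gt_0_iff)
  have kpos: "0 < k y w" for y w using M by (simp add: k_def)
  have ksum: "(\<Sum>w\<in>S. k y w) \<le> 1" for y
  proof -
    have "(\<Sum>w\<in>S. k y w) \<le> (\<Sum>w\<in>S. (if w = dec y then 1/2 else 0) + 1/(2 * ?M))"
      using M by (intro sum_mono) (auto simp: k_def)
    also have "\<dots> \<le> 1" using S(1) M by (simp add: sum.distrib)
    finally show ?thesis .
  qed
  have q0: "0 \<le> q u" for u using kpos by (auto simp: q_def less_imp_le split: prod.split)
  have "(\<Sum>u\<in>(\<lambda>\<omega>. (W \<omega>, Y \<omega>)) ` set_pmf p. q u) \<le> (\<Sum>u\<in>S \<times> Y ` set_pmf p. q u)"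
    using fin S q0 by (intro sum_mono2) auto
  also have "\<dots> = (\<Sum>w\<in>S. \<Sum>y\<in>Y ` set_pmf p. q (w, y))" by (simp add: sum.cartesian_product)
  also have "\<dots> = (\<Sum>y\<in>Y ` set_pmf p. \<Sum>w\<in>S. q (w, y))" by (rule sum.swap)
  also have "\<dots> = (\<Sum>y\<in>Y ` set_pmf p. ?Y y * (\<Sum>w\<in>S. k y w))" by (simp add: q_def sum_distrib_left)
  also have "\<dots> \<le> (\<Sum>y\<in>Y ` set_pmf p. ?Y y * 1)" by (intro sum_mono mult_left_mono ksum) auto
  also have "\<dots> = 1" using fin by (simp add: sum_pmf_eq_1)
  finally have sub: "(\<Sum>u\<in>(\<lambda>\<omega>. (W \<omega>, Y \<omega>)) ` set_pmf p. q u) \<le> 1" .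
  have "ent p (\<lambda>\<omega>. (W \<omega>, Y \<omega>)) \<le> ?E (\<lambda>\<omega>. - log 2 (q (W \<omega>, Y \<omega>)))"
    using kpos pmf_map_pos[of _ p Y] by (intro gibbs[OF fin _ sub]) (auto simp: q_def)
  also have "\<dots> = ?E (\<lambda>\<omega>. (- log 2 (?Y (Y \<omega>)) + 1) + indicator {\<omega>. dec (Y \<omega>) \<noteq> W \<omega>} \<omega> * log 2 ?M)"
    using kpos pmf_map_pos[of _ p Y] M by (intro integral_cong_AE)
      (auto simp: AE_measure_pmf_iff q_def k_def log_mult log_divide less_imp_neq[THEN not_sym])
  also have "\<dots> = ent p Y + 1 + measure_pmf.prob p {\<omega>. dec (Y \<omega>) \<noteq> W \<omega>} * log 2 ?M"
    unfolding ent_def by (subst Bochner_Integration.integral_add[OF int int],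
      subst Bochner_Integration.integral_add[OF int int]) simp
  finally show ?thesis .
qed

section \<open>Mutual information in terms of entropies, and its vanishing for product laws\<close>

lemma mutual_info_eq_ent:
  assumes fin: "finite (set_pmf p)"
  shows "mutual_info p X Y = ent p X + ent p Y - ent p (\<lambda>\<omega>. (X \<omega>, Y \<omega>))"
proof -
  let ?E = "measure_pmf.expectation p"
  let ?J = "map_pmf (\<lambda>\<omega>. (X \<omega>, Y \<omega>)) p"
  let ?X = "pmf (map_pmf X p)" and ?Y = "pmf (map_pmf Y p)"
  note int = integrable_measure_pmf_finite[OF fin]
  note pos = pmf_map_pos[of _ p "\<lambda>\<omega>. (X \<omega>, Y \<omega>)"] pmf_map_pos[of _ p X] pmf_map_pos[of _ p Y]
  have "mutual_info p X Y = measure_pmf.expectation ?J (\<lambda>(a, b). log 2 (pmf ?J (a, b) / (?X a * ?Y b)))"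
    unfolding mutual_info_def Let_def using fin
    by (subst integral_measure_pmf_real[of "set_pmf ?J"]) (auto simp: case_prod_unfold mult.commute)
  also have "\<dots> = ?E (\<lambda>\<omega>. log 2 (pmf ?J (X \<omega>, Y \<omega>) / (?X (X \<omega>) * ?Y (Y \<omega>))))" by simp
  also have "\<dots> = ?E (\<lambda>\<omega>. (- log 2 (?X (X \<omega>)) + - log 2 (?Y (Y \<omega>))) - - log 2 (pmf ?J (X \<omega>, Y \<omega>)))"
    using pos by (intro integral_cong_AE)
      (auto simp: AE_measure_pmf_iff log_mult log_divide less_imp_neq[THEN not_sym])
  also have "\<dots> = ent p X + ent p Y - ent p (\<lambda>\<omega>. (X \<omega>, Y \<omega>))"
    unfolding ent_def by (subst Bochner_Integration.integral_diff[OF int int],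
      subst Bochner_Integration.integral_add[OF int int]) (rule refl)
  finally show ?thesis .
qed

lemma mutual_info_map_pmf: "mutual_info (map_pmf g p) X Y = mutual_info p (X \<circ> g) (Y \<circ> g)"
  by (simp add: mutual_info_def map_pmf_comp o_def)

text \<open>The factors are arbitrary, so a caller only has to exhibit some product form; they are
  then forced to be the marginals, and every logarithm is that of 1.\<close>

lemma mutual_info_eq_0:
  assumes "map_pmf (\<lambda>\<omega>. (X \<omega>, Y \<omega>)) p = pair_pmf A B"
  shows "mutual_info p X Y = 0"
proof -
  have "map_pmf X p = map_pmf fst (map_pmf (\<lambda>\<omega>. (X \<omega>, Y \<omega>)) p)" by (simp add: map_pmf_comp)
  then have A: "map_pmf X p = A" by (simp add: assms map_fst_pair_pmf)
  have "map_pmf Y p = map_pmf snd (map_pmf (\<lambda>\<omega>. (X \<omega>, Y \<omega>)) p)" by (simp add: map_pmf_comp)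
  then have B: "map_pmf Y p = B" by (simp add: assms map_snd_pair_pmf)
  show ?thesis unfolding mutual_info_def assms A B Let_def
    by (intro sum.neutral) (auto simp: pmf_pair set_pmf_iff)
qed

section \<open>Outer bound for a block\<close>

text \<open>A block is encoded as its set of nonzero positions \<open>(time, level)\<close>; blocks
  then range over a finite power set, whose exponent counts bits.\<close>

definition input_set :: "nat \<Rightarrow> nat \<Rightarrow> (nat \<Rightarrow> nat \<Rightarrow> bool) \<Rightarrow> (nat \<times> nat) set" where
  "input_set N k x = {(t, j). t < N \<and> j < k \<and> x t j}"

definition block_y1 :: "nat \<Rightarrow> nat \<Rightarrow> nat \<Rightarrow> (nat \<times> nat) set \<Rightarrow> (nat \<times> nat) set \<Rightarrow> nat \<Rightarrow> nat \<Rightarrow> bool" where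
  "block_y1 m n N X1 X2 = (\<lambda>t l. t < N \<and> l < qdim m n \<and>
     ((qdim m n - m \<le> l \<and> (t, l - (qdim m n - m)) \<in> X1) \<noteq>
      (qdim m n - n \<le> l \<and> (t, l - (qdim m n - n)) \<in> X2)))"

definition block_y2 :: "nat \<Rightarrow> nat \<Rightarrow> nat \<Rightarrow> (nat \<times> nat) set \<Rightarrow> nat \<Rightarrow> nat \<Rightarrow> bool" where
  "block_y2 m n N X2 = (\<lambda>t l. t < N \<and> l < qdim m n \<and>
     qdim m n - m \<le> l \<and> (t, l - (qdim m n - m)) \<in> X2)"

lemma downshift_pow_eq: "downshift_pow q k x = (\<lambda>j. j < q \<and> k \<le> j \<and> x (j - k))"
proof (induction k)
  case 0
  show ?case by (simp add: downshift_pow_def trunc_vec_def)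
next
  case (Suc k)
  have step: "downshift_pow q (Suc k) x = downshift q (downshift_pow q k x)"
    by (simp add: downshift_pow_def)
  show ?case
  proof
    fix j show "downshift_pow q (Suc k) x j = (j < q \<and> Suc k \<le> j \<and> x (j - Suc k))"
      unfolding step Suc downshift_def by (cases j) auto
  qed
qed

text \<open>Only the top \<open>m\<close> levels of the first input survive its shift, hence the cut
  at \<open>m\<close>. The second input keeps all its levels, because the two receivers see
  different portions of it.\<close>

lemma out1_eq:
  "out1 m n N c (w1, w2, r1, r2) = block_y1 m n N
     (input_set N m (enc1 c w1 r1 (coop c w2 r2))) (input_set N (qdim m n) (enc2 c w2 r2))"
proof (intro ext)
  fix t l
  let ?x1 = "enc1 c w1 r1 (coop c w2 r2)" and ?x2 = "enc2 c w2 r2"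
  have "l - (qdim m n - m) < m" if "l < qdim m n" "qdim m n - m \<le> l"
    using that by (auto simp: qdim_def)
  then show "out1 m n N c (w1, w2, r1, r2) t l =
      block_y1 m n N (input_set N m ?x1) (input_set N (qdim m n) ?x2) t l"
    unfolding out1_def block_y1_def input_set_def chan_y1_def vadd_def downshift_pow_eq prod.case
      mem_Collect_eq if_distrib[of "\<lambda>f. f l"]
    by (cases "t < N"; cases "l < qdim m n"; cases "qdim m n - m \<le> l") (simp_all add: less_imp_diff_less)
qed

lemma out2_eq:
  "out2 m n N c (w1, w2, r1, r2) = block_y2 m n N (input_set N (qdim m n) (enc2 c w2 r2))"
proof (intro ext)
  fix t l
  show "out2 m n N c (w1, w2, r1, r2) t l = block_y2 m n N (input_set N (qdim m n) (enc2 c w2 r2)) t l"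
    unfolding out2_def block_y2_def input_set_def chan_y2_def trunc_vec_def downshift_pow_eq prod.case
      mem_Collect_eq if_distrib[of "\<lambda>f. f l"]
    by (cases "t < N"; cases "l < qdim m n") (simp_all add: less_imp_diff_less)
qed

section \<open>What the outputs depend on and what they reveal\<close>

lemma block_y1_cong:
  assumes "X1 \<inter> {..<N} \<times> {..<m} = X1' \<inter> {..<N} \<times> {..<m}"
    and "X2 \<inter> {..<N} \<times> {..<n} = X2' \<inter> {..<N} \<times> {..<n}"
  shows "block_y1 m n N X1 X2 = block_y1 m n N X1' X2'"
proof -
  have "((t, l - (qdim m n - m)) \<in> X1) = ((t, l - (qdim m n - m)) \<in> X1')"
    if "t < N" "l < qdim m n" "qdim m n - m \<le> l" for t l
  proof -
    have "(t, l - (qdim m n - m)) \<in> {..<N} \<times> {..<m}" using that by (auto simp: qdim_def)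
    then show ?thesis using assms(1) by blast
  qed
  moreover have "((t, l - (qdim m n - n)) \<in> X2) = ((t, l - (qdim m n - n)) \<in> X2')"
    if "t < N" "l < qdim m n" "qdim m n - n \<le> l" for t l
  proof -
    have "(t, l - (qdim m n - n)) \<in> {..<N} \<times> {..<n}" using that by (auto simp: qdim_def)
    then show ?thesis using assms(2) by blast
  qed
  ultimately show ?thesis unfolding block_y1_def fun_eq_iff by blast
qed

lemma block_y2_cong:
  assumes "X2 \<inter> {..<N} \<times> {..<m} = X2' \<inter> {..<N} \<times> {..<m}"
  shows "block_y2 m n N X2 = block_y2 m n N X2'"
proof -
  have "((t, l - (qdim m n - m)) \<in> X2) = ((t, l - (qdim m n - m)) \<in> X2')"
    if "t < N" "l < qdim m n" "qdim m n - m \<le> l" for t l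
  proof -
    have "(t, l - (qdim m n - m)) \<in> {..<N} \<times> {..<m}" using that by (auto simp: qdim_def)
    then show ?thesis using assms by blast
  qed
  then show ?thesis unfolding block_y2_def fun_eq_iff by blast
qed

lemma Int_levels_cong:
  fixes A B :: "(nat \<times> nat) set"
  assumes "A \<inter> {..<N} \<times> {..<a} = B \<inter> {..<N} \<times> {..<a}"
    and "A \<inter> {..<N} \<times> {a..<b} = B \<inter> {..<N} \<times> {a..<b}"
  shows "A \<inter> {..<N} \<times> {..<b} = B \<inter> {..<N} \<times> {..<b}"
proof -
  have "{..<N} \<times> {..<b} \<subseteq> {..<N} \<times> {..<a} \<union> {..<N} \<times> {a..<b}" by auto
  then show ?thesis using assms by blast
qed

text \<open>Addition mod 2 is cancellable: with the first input fixed, level \<open>j\<close> of the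
  second can be read off at output level \<open>j + (qdim m n - n)\<close>.\<close>

lemma block_y1_inject2:
  assumes "block_y1 m n N X1 X2 = block_y1 m n N X1 X2'"
  shows "X2 \<inter> {..<N} \<times> {..<n} = X2' \<inter> {..<N} \<times> {..<n}"
proof -
  have "((t, j) \<in> X2) = ((t, j) \<in> X2')" if "t < N" "j < n" for t j
    using fun_cong[OF fun_cong[OF assms, of t], of "j + (qdim m n - n)"] that
    by (auto simp: block_y1_def qdim_def)
  then show ?thesis by auto
qed

text \<open>The top \<^term>\<open>n - m\<close> levels of the second input reach receiver 1 without interference.\<close>

lemma block_y1_top:
  assumes "block_y1 m n N X1 X2 = block_y1 m n N X1' X2'"
  shows "X2 \<inter> {..<N} \<times> {..<n - m} = X2' \<inter> {..<N} \<times> {..<n - m}"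
proof -
  have "((t, j) \<in> X2) = ((t, j) \<in> X2')" if "t < N" "j < n - m" for t j
    using fun_cong[OF fun_cong[OF assms, of t], of j] that
    by (auto simp: block_y1_def qdim_def max_def split: if_splits)
  then show ?thesis by auto
qed

text \<open>The transmission of a block as seen by the converse: \<open>U\<close> holds message 1 and the strategy of
  transmitter 1 (its map from link sequences to input blocks), \<open>V\<close> holds message 2, the link
  sequence and the input block of transmitter 2.\<close>

locale zic_block =
  fixes p :: "'o pmf" and U :: "'o \<Rightarrow> 'a \<times> 's" and V :: "'o \<Rightarrow> 'b \<times> 'l \<times> (nat \<times> nat) set"
    and x1 :: "'s \<Rightarrow> 'l \<Rightarrow> (nat \<times> nat) set" and m n N C :: nat and T :: "'l set"
  assumes fin: "finite (set_pmf p)"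
    and ind: "map_pmf (\<lambda>\<omega>. (U \<omega>, V \<omega>)) p = pair_pmf (map_pmf U p) (map_pmf V p)"
    and link: "(\<lambda>\<omega>. fst (snd (V \<omega>))) ` set_pmf p \<subseteq> T" "finite T" "card T = 2 ^ (N * C)"
    and x1: "\<And>\<omega>. \<omega> \<in> set_pmf p \<Longrightarrow> x1 (snd (U \<omega>)) (fst (snd (V \<omega>))) \<subseteq> {..<N} \<times> {..<m}"
begin

abbreviation "W1 \<omega> \<equiv> fst (U \<omega>)"
abbreviation "W2 \<omega> \<equiv> fst (V \<omega>)"
abbreviation "L \<omega> \<equiv> fst (snd (V \<omega>))"
abbreviation "X1 \<omega> \<equiv> x1 (snd (U \<omega>)) (L \<omega>)"
abbreviation "X2 \<omega> \<equiv> snd (snd (V \<omega>)) \<inter> {..<N} \<times> {..<n}"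
abbreviation "Y1 \<omega> \<equiv> block_y1 m n N (X1 \<omega>) (snd (snd (V \<omega>)))"
abbreviation "Y2 \<omega> \<equiv> block_y2 m n N (snd (snd (V \<omega>)))"
abbreviation "H \<equiv> ent p"

lemma ent_split: "H (\<lambda>\<omega>. (f (U \<omega>), g (V \<omega>))) = H (\<lambda>\<omega>. f (U \<omega>)) + H (\<lambda>\<omega>. g (V \<omega>))"
proof (rule ent_indep[OF fin])
  have "map_pmf (\<lambda>\<omega>. (f (U \<omega>), g (V \<omega>))) p = map_pmf (\<lambda>(u, v). (f u, g v)) (map_pmf (\<lambda>\<omega>. (U \<omega>, V \<omega>)) p)"
    by (simp add: map_pmf_comp)
  also have "\<dots> = pair_pmf (map_pmf f (map_pmf U p)) (map_pmf g (map_pmf V p))"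
    unfolding ind by (rule map_pair)
  finally show "map_pmf (\<lambda>\<omega>. (f (U \<omega>), g (V \<omega>))) p =
    pair_pmf (map_pmf (\<lambda>\<omega>. f (U \<omega>)) p) (map_pmf (\<lambda>\<omega>. g (V \<omega>)) p)"
    by (simp add: map_pmf_comp)
qed

lemma ent_X1: "H X1 \<le> N * m"
proof -
  have "X1 ` set_pmf p \<subseteq> Pow ({..<N} \<times> {..<m})" using x1 by blast
  then have "H X1 \<le> card ({..<N} \<times> {..<m})" by (intro ent_le_card_bits[OF fin]) auto
  then show ?thesis by (simp add: card_cartesian_product)
qed

lemma ent_link: "H L \<le> N * C"
  using ent_le_log_card[OF fin link(2,1)] link(3) by (simp add: log_nat_power)

lemma ent_levels: "H (\<lambda>\<omega>. snd (snd (V \<omega>)) \<inter> {..<N} \<times> {a..<b}) \<le> real N * real (b - a)"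
proof -
  have "H (\<lambda>\<omega>. snd (snd (V \<omega>)) \<inter> {..<N} \<times> {a..<b}) \<le> card ({..<N} \<times> {a..<b})"
    by (intro ent_le_card_bits[OF fin]) auto
  then show ?thesis by (simp add: card_cartesian_product)
qed

text \<open>Once \<open>X2\<close> is known, \<open>Y1\<close> is a function of \<open>X1\<close>,
  which has at most \<open>N * m\<close> bits.\<close>

lemma ent_X2_Y1: "H (\<lambda>\<omega>. (X2 \<omega>, Y1 \<omega>)) \<le> H X2 + N * m"
proof -
  have "H (\<lambda>\<omega>. (X2 \<omega>, Y1 \<omega>)) \<le> H (\<lambda>\<omega>. (X2 \<omega>, X1 \<omega>))"
  proof (rule ent_mono[OF fin])
    fix \<omega> \<omega>' assume "(X2 \<omega>', X1 \<omega>') = (X2 \<omega>, X1 \<omega>)"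
    then have x: "X2 \<omega>' = X2 \<omega>" "X1 \<omega>' = X1 \<omega>" by blast+
    have "Y1 \<omega>' = Y1 \<omega>" unfolding x(2) by (rule block_y1_cong[OF refl x(1)])
    then show "(X2 \<omega>', Y1 \<omega>') = (X2 \<omega>, Y1 \<omega>)" using x(1) by (simp only:)
  qed
  also have "\<dots> \<le> H X2 + H X1" by (rule ent_subadditive[OF fin])
  finally show ?thesis using ent_X1 by linarith
qed

text \<open>\<open>W1\<close> and \<open>X2\<close> are independent, so their entropies add;
  submodularity over \<open>Y1\<close> then trades \<open>H X2\<close> away against
  \<open>ent_X2_Y1\<close>. The bracket is the equivocation of message 1 at its receiver, to be
  bounded by Fano's inequality.\<close>

lemma rate1_bound: "H W1 \<le> N * m + (H (\<lambda>\<omega>. (W1 \<omega>, Y1 \<omega>)) - H Y1)"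
proof -
  have "H W1 + H X2 = H (\<lambda>\<omega>. (W1 \<omega>, X2 \<omega>))"
    using ent_split[of fst "\<lambda>v. snd (snd v) \<inter> {..<N} \<times> {..<n}"] by simp
  also have "\<dots> \<le> H (\<lambda>\<omega>. (W1 \<omega>, X2 \<omega>, Y1 \<omega>))" by (rule ent_mono[OF fin]) auto
  finally show ?thesis using ent_submodular[OF fin, of W1 X2 Y1] ent_X2_Y1 by linarith
qed

text \<open>The three terms are the leakage to receiver 1, the equivocation at receiver 2, and what
  receiver 2 sees beyond receiver 1. Both rate bounds that involve message 2 come from estimating
  the last term.\<close>

lemma ent_W2_le:
  "H W2 \<le> mutual_info p W2 Y1 + (H (\<lambda>\<omega>. (W2 \<omega>, Y2 \<omega>)) - H Y2) + (H (\<lambda>\<omega>. (Y1 \<omega>, Y2 \<omega>)) - H Y1)"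
proof -
  have "H (\<lambda>\<omega>. (W2 \<omega>, Y1 \<omega>)) \<le> H (\<lambda>\<omega>. (W2 \<omega>, Y1 \<omega>, Y2 \<omega>))"
    by (rule ent_mono[OF fin]) blast
  then show ?thesis
    using ent_submodular[OF fin, of W2 Y1 Y2] mutual_info_eq_ent[OF fin, of W2 Y1] by linarith
qed

text \<open>Receiver 1 reads the top \<open>n - m\<close> levels of the second input in the clear,
  so given \<open>Y1\<close> only the levels from \<open>n - m\<close> to \<open>m - 1\<close> can
  add anything to \<open>Y2\<close>.\<close>

lemma rate2_bound:
  "H W2 \<le> mutual_info p W2 Y1 + (H (\<lambda>\<omega>. (W2 \<omega>, Y2 \<omega>)) - H Y2) + real N * real (m - (n - m))"
proof -
  let ?Z = "\<lambda>\<omega>. snd (snd (V \<omega>)) \<inter> {..<N} \<times> {n - m..<m}"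
  have "H (\<lambda>\<omega>. (Y1 \<omega>, Y2 \<omega>)) \<le> H (\<lambda>\<omega>. (Y1 \<omega>, ?Z \<omega>))"
  proof (rule ent_mono[OF fin])
    fix \<omega> \<omega>' assume "(Y1 \<omega>', ?Z \<omega>') = (Y1 \<omega>, ?Z \<omega>)"
    then have y: "Y1 \<omega>' = Y1 \<omega>" and z: "?Z \<omega>' = ?Z \<omega>" by blast+
    have "snd (snd (V \<omega>')) \<inter> {..<N} \<times> {..<m} = snd (snd (V \<omega>)) \<inter> {..<N} \<times> {..<m}"
      by (rule Int_levels_cong[OF block_y1_top[OF y] z])
    then have "Y2 \<omega>' = Y2 \<omega>" by (rule block_y2_cong)
    then show "(Y1 \<omega>', Y2 \<omega>') = (Y1 \<omega>, Y2 \<omega>)" using y by (simp only:)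
  qed
  also have "\<dots> \<le> H Y1 + H ?Z" by (rule ent_subadditive[OF fin])
  finally show ?thesis using ent_W2_le ent_levels[of "n - m" m] by linarith
qed

text \<open>Given message 1 and the link sequence, the first input carries no information on the
  second one, so receiver 1 is left with all but \<^term>\<open>N * C\<close> bits of the interference.\<close>

lemma ent_interference: "H W1 + H X2 \<le> H (\<lambda>\<omega>. (Y1 \<omega>, W1 \<omega>)) + N * C"
proof -
  let ?SL = "\<lambda>\<omega>. (snd (U \<omega>), L \<omega>)"
  \<comment> \<open>Knowing the strategy and the link sequence fixes the first input, and then
    \<open>Y1\<close> reveals \<open>X2\<close>.\<close>
  have "H U + H (\<lambda>\<omega>. (X2 \<omega>, L \<omega>)) = H (\<lambda>\<omega>. (U \<omega>, (X2 \<omega>, L \<omega>)))"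
    using ent_split[of "\<lambda>u. u" "\<lambda>v. (snd (snd v) \<inter> {..<N} \<times> {..<n}, fst (snd v))"] by simp
  also have "\<dots> \<le> H (\<lambda>\<omega>. (Y1 \<omega>, ?SL \<omega>, W1 \<omega>))"
  proof (rule ent_mono[OF fin])
    fix \<omega> \<omega>' assume "(Y1 \<omega>', ?SL \<omega>', W1 \<omega>') = (Y1 \<omega>, ?SL \<omega>, W1 \<omega>)"
    then have y: "Y1 \<omega>' = Y1 \<omega>" and s: "snd (U \<omega>') = snd (U \<omega>)" and l: "L \<omega>' = L \<omega>"
      and w: "W1 \<omega>' = W1 \<omega>" by blast+
    have "X2 \<omega>' = X2 \<omega>" using y unfolding s l by (rule block_y1_inject2)
    moreover have "U \<omega>' = U \<omega>" using w s by (rule prod_eqI)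
    ultimately show "(U \<omega>', (X2 \<omega>', L \<omega>')) = (U \<omega>, (X2 \<omega>, L \<omega>))" using l by (simp only:)
  qed
  finally have "H U + H (\<lambda>\<omega>. (X2 \<omega>, L \<omega>)) \<le> H (\<lambda>\<omega>. (Y1 \<omega>, ?SL \<omega>, W1 \<omega>))" .
  moreover have "H X2 \<le> H (\<lambda>\<omega>. (X2 \<omega>, L \<omega>))" by (rule ent_mono[OF fin]) blast
  ultimately have lower: "H U + H X2 \<le> H (\<lambda>\<omega>. (Y1 \<omega>, ?SL \<omega>, W1 \<omega>))" by linarith
  have "H (\<lambda>\<omega>. (?SL \<omega>, W1 \<omega>)) \<le> H (\<lambda>\<omega>. (U \<omega>, L \<omega>))"
    by (rule ent_mono[OF fin]) (simp only: prod.inject)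
  also have "\<dots> \<le> H U + H L" by (rule ent_subadditive[OF fin])
  finally show ?thesis
    using lower ent_link ent_submodular[OF fin, of Y1 ?SL W1] by linarith
qed

text \<open>\<open>X2\<close> and the levels from \<open>n\<close> on determine \<open>Y2\<close>,
  which bounds the joint entropy of the outputs by \<open>H X2\<close> plus constants; adding
  \<open>ent_interference\<close> to \<open>ent_W2_le\<close> makes \<open>H X2\<close>
  cancel.\<close>

lemma sum_rate_bound:
  "H W1 + H W2 \<le> mutual_info p W2 Y1 + (H (\<lambda>\<omega>. (W1 \<omega>, Y1 \<omega>)) - H Y1)
     + (H (\<lambda>\<omega>. (W2 \<omega>, Y2 \<omega>)) - H Y2) + real N * real (m + (m - n) + C)"
proof -
  let ?Z = "\<lambda>\<omega>. snd (snd (V \<omega>)) \<inter> {..<N} \<times> {n..<m}"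
  have "H (\<lambda>\<omega>. (Y1 \<omega>, Y2 \<omega>)) \<le> H (\<lambda>\<omega>. ((X2 \<omega>, Y1 \<omega>), ?Z \<omega>))"
  proof (rule ent_mono[OF fin])
    fix \<omega> \<omega>' assume "((X2 \<omega>', Y1 \<omega>'), ?Z \<omega>') = ((X2 \<omega>, Y1 \<omega>), ?Z \<omega>)"
    then have y: "Y1 \<omega>' = Y1 \<omega>" and x: "X2 \<omega>' = X2 \<omega>" and z: "?Z \<omega>' = ?Z \<omega>" by blast+
    have "snd (snd (V \<omega>')) \<inter> {..<N} \<times> {..<m} = snd (snd (V \<omega>)) \<inter> {..<N} \<times> {..<m}"
      by (rule Int_levels_cong[OF x z])
    then have "Y2 \<omega>' = Y2 \<omega>" by (rule block_y2_cong)
    then show "(Y1 \<omega>', Y2 \<omega>') = (Y1 \<omega>, Y2 \<omega>)" using y by (simp only:)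
  qed
  also have "\<dots> \<le> H (\<lambda>\<omega>. (X2 \<omega>, Y1 \<omega>)) + H ?Z" by (rule ent_subadditive[OF fin])
  finally have "H (\<lambda>\<omega>. (Y1 \<omega>, Y2 \<omega>)) \<le> H X2 + N * m + real N * real (m - n)"
    using ent_X2_Y1 ent_levels[of n m] by linarith
  moreover have "H (\<lambda>\<omega>. (Y1 \<omega>, W1 \<omega>)) \<le> H (\<lambda>\<omega>. (W1 \<omega>, Y1 \<omega>))" by (rule ent_mono[OF fin]) blast
  ultimately show ?thesis using ent_interference ent_W2_le by (simp add: algebra_simps)
qed

end

section \<open>Outer bound on the weak secrecy region\<close>

text \<open>Regrouping each message with the randomness of its own transmitter exhibits the two
  sides as independent.\<close>

lemma code_space_eq:
  "code_space M1 M2 c = map_pmf (\<lambda>((w1, r1), (w2, r2)). (w1, w2, r1, r2))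
     (pair_pmf (pair_pmf (pmf_of_set {0..<M1}) (rnd1 c)) (pair_pmf (pmf_of_set {0..<M2}) (rnd2 c)))"
  unfolding code_space_def pair_pmf_def
  by (simp add: map_bind_pmf bind_assoc_pmf bind_return_pmf)
    (subst bind_commute_pmf, rule refl)

text \<open>The private randomness may have infinite support, so entropies are not taken on
  \<open>code_space\<close> itself. Transmitter 1 is replaced by its strategy on the finite set
  \<open>T\<close> of link sequences, transmitter 2 by its link sequence and input block; the image
  law \<open>p\<close> has finite support and satisfies \<open>zic_block\<close>.\<close>

lemma code_converse:
  fixes m n N :: nat
  assumes c: "valid_code C c" and M: "1 \<le> M1" "1 \<le> M2"
  defines "err \<equiv> error_prob m n N M1 M2 c"
    and "leak \<equiv> mutual_info (code_space M1 M2 c) msgW2 (out1 m n N c)"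
  shows "log 2 M1 \<le> N * m + (1 + err * log 2 M1)"
    and "log 2 M2 \<le> leak + (1 + err * log 2 M2) + real N * real (m - (n - m))"
    and "log 2 M1 + log 2 M2 \<le> leak + (1 + err * log 2 M1) + (1 + err * log 2 M2)
       + real N * real (m + (m - n) + C)"
proof -
  define T where "T = PiE {..<N} (\<lambda>_. {..<(2::nat) ^ C})"
  define S where "S = (\<lambda>w r. restrict (\<lambda>v. input_set N m (enc1 c w r v)) T)"
  define L where "L = (\<lambda>w r. restrict (coop c w r) {..<N})"
  define X2 where "X2 = (\<lambda>w r. input_set N (qdim m n) (enc2 c w r))"
  define g1 where "g1 = (\<lambda>(w, r). (w, S w r))"
  define g2 where "g2 = (\<lambda>(w, r). (w, L w r, X2 w r))"
  define R where "R = pair_pmf (pair_pmf (pmf_of_set {0..<M1}) (rnd1 c)) (pair_pmf (pmf_of_set {0..<M2}) (rnd2 c))"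
  define p where "p = map_pmf (map_prod g1 g2) R"
  have T: "finite T" "card T = 2 ^ (N * C)"
    by (auto simp: T_def card_PiE finite_PiE power_mult[symmetric] mult.commute)
  have L: "L w r \<in> T" for w r using c by (auto simp: L_def T_def valid_code_def)
  \<comment> \<open>Cutting the link sequence off at \<open>N\<close> changes nothing by causality:
    an input at time \<open>t < N\<close> reads only earlier symbols.\<close>
  have S: "S w r (L w' r') = input_set N m (enc1 c w r (coop c w' r'))" for w r w' r'
  proof -
    have "enc1 c w r (L w' r') t = enc1 c w r (coop c w' r') t" if "t < N" for t
    proof -
      have "\<forall>s<t. L w' r' s = coop c w' r' s" using that by (auto simp: L_def)
      then show ?thesis using c unfolding valid_code_def by blast
    qed
    then show ?thesis using L[of w' r'] by (auto simp: S_def input_set_def)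
  qed
  have inp: "input_set N k x \<in> Pow ({..<N} \<times> {..<k})" for k x by (auto simp: input_set_def)
  have "finite (PiE T (\<lambda>_. Pow ({..<N} \<times> {..<m})))" using T(1) by (intro finite_PiE) auto
  moreover have "g1 ` ({0..<M1} \<times> UNIV) \<subseteq> {0..<M1} \<times> PiE T (\<lambda>_. Pow ({..<N} \<times> {..<m}))"
    by (auto simp: g1_def S_def input_set_def)
  ultimately have fin1: "finite (g1 ` ({0..<M1} \<times> UNIV))" by (meson finite_SigmaI finite_atLeastLessThan finite_subset)
  have "g2 ` ({0..<M2} \<times> UNIV) \<subseteq> {0..<M2} \<times> T \<times> Pow ({..<N} \<times> {..<qdim m n})"
    using L by (auto simp: g2_def X2_def input_set_def)
  then have fin2: "finite (g2 ` ({0..<M2} \<times> UNIV))" by (rule finite_subset) (use T(1) in auto)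
  have nonempty: "{0..<M1} \<noteq> {}" "{0..<M2} \<noteq> {}" using M by auto
  have p: "p = pair_pmf (map_pmf g1 (pair_pmf (pmf_of_set {0..<M1}) (rnd1 c)))
      (map_pmf g2 (pair_pmf (pmf_of_set {0..<M2}) (rnd2 c)))"
    unfolding p_def R_def by (simp add: map_pair[symmetric] map_prod_def)
  have suppR: "set_pmf R \<subseteq> ({0..<M1} \<times> UNIV) \<times> ({0..<M2} \<times> UNIV)"
    using nonempty by (auto simp: R_def)
  have supp: "set_pmf p \<subseteq> g1 ` ({0..<M1} \<times> UNIV) \<times> g2 ` ({0..<M2} \<times> UNIV)"
    using suppR by (force simp: p_def)
  interpret zic_block p fst snd "\<lambda>s l. s l" m n N C T
  proof
    show "finite (set_pmf p)" using finite_subset[OF supp] fin1 fin2 by blast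
    show "map_pmf (\<lambda>\<omega>. (fst \<omega>, snd \<omega>)) p = pair_pmf (map_pmf fst p) (map_pmf snd p)"
      by (simp add: p map_fst_pair_pmf map_snd_pair_pmf)
    show "(\<lambda>\<omega>. fst (snd (snd \<omega>))) ` set_pmf p \<subseteq> T" using supp L by (force simp: g2_def)
    show "snd (fst \<omega>) (fst (snd (snd \<omega>))) \<subseteq> {..<N} \<times> {..<m}" if "\<omega> \<in> set_pmf p" for \<omega>
    proof -
      have "\<omega> \<in> g1 ` ({0..<M1} \<times> UNIV) \<times> g2 ` ({0..<M2} \<times> UNIV)" using supp that by (rule subsetD)
      then obtain u v where "\<omega> = (g1 u, g2 v)" by (elim SigmaE imageE) simp
      then show ?thesis using inp by (cases u; cases v) (simp add: g1_def g2_def S)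
    qed
  qed (use T in auto)
  \<comment> \<open>Both \<open>p\<close> and \<open>code_space\<close> are images of
    \<open>R\<close>, under \<open>?\<gamma>\<close> and \<open>?\<rho>\<close>; messages and
    outputs agree after pulling back to \<open>R\<close>, so leakage and errors transfer.\<close>
  let ?\<gamma> = "map_prod g1 g2" and ?\<rho> = "\<lambda>((w1, r1), (w2, r2)). (w1, w2, r1, r2)"
  have cs: "code_space M1 M2 c = map_pmf ?\<rho> R" by (simp add: code_space_eq R_def)
  have W: "W1 (?\<gamma> \<omega>) = msgW1 (?\<rho> \<omega>)" "W2 (?\<gamma> \<omega>) = msgW2 (?\<rho> \<omega>)" for \<omega>
    by (auto simp: g1_def g2_def msgW1_def msgW2_def split: prod.splits)
  have Y: "Y1 (?\<gamma> \<omega>) = out1 m n N c (?\<rho> \<omega>)" "Y2 (?\<gamma> \<omega>) = out2 m n N c (?\<rho> \<omega>)" for \<omega>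
    by (cases \<omega>; auto simp: g1_def g2_def S X2_def out1_eq out2_eq split: prod.splits)+
  have leak: "leak = mutual_info p W2 Y1"
  proof -
    have "W2 \<circ> ?\<gamma> = msgW2 \<circ> ?\<rho>" "Y1 \<circ> ?\<gamma> = out1 m n N c \<circ> ?\<rho>"
      by (intro ext; simp only: o_apply W Y)+
    then show ?thesis unfolding leak_def p_def cs mutual_info_map_pmf by (simp only:)
  qed
  have err1: "measure p {\<omega>. dec1 c (Y1 \<omega>) \<noteq> W1 \<omega>} \<le> err"
    unfolding err_def p_def cs error_prob_def measure_map_pmf
  proof (intro measure_pmf.finite_measure_mono subsetI)
    fix \<omega> assume "\<omega> \<in> ?\<gamma> -` {\<omega>. dec1 c (Y1 \<omega>) \<noteq> W1 \<omega>}"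
    then show "\<omega> \<in> ?\<rho> -` {\<omega>. dec1 c (out1 m n N c \<omega>) \<noteq> msgW1 \<omega> \<or> dec2 c (out2 m n N c \<omega>) \<noteq> msgW2 \<omega>}"
      unfolding vimage_eq mem_Collect_eq W Y by blast
  qed simp
  have err2: "measure p {\<omega>. dec2 c (Y2 \<omega>) \<noteq> W2 \<omega>} \<le> err"
    unfolding err_def p_def cs error_prob_def measure_map_pmf
  proof (intro measure_pmf.finite_measure_mono subsetI)
    fix \<omega> assume "\<omega> \<in> ?\<gamma> -` {\<omega>. dec2 c (Y2 \<omega>) \<noteq> W2 \<omega>}"
    then show "\<omega> \<in> ?\<rho> -` {\<omega>. dec1 c (out1 m n N c \<omega>) \<noteq> msgW1 \<omega> \<or> dec2 c (out2 m n N c \<omega>) \<noteq> msgW2 \<omega>}"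
      unfolding vimage_eq mem_Collect_eq W Y by blast
  qed simp
  have range: "W1 ` set_pmf p \<subseteq> {0..<M1}" "W2 ` set_pmf p \<subseteq> {0..<M2}"
    using supp by (force simp: g1_def g2_def)+
  have log0: "0 \<le> log 2 (real M1)" "0 \<le> log 2 (real M2)" using M by auto
  have "H (\<lambda>\<omega>. (W1 \<omega>, Y1 \<omega>)) \<le> H Y1 + 1 + measure p {\<omega>. dec1 c (Y1 \<omega>) \<noteq> W1 \<omega>} * log 2 M1"
    using fano[OF fin _ range(1), of Y1 "dec1 c"] by simp
  then have F1: "H (\<lambda>\<omega>. (W1 \<omega>, Y1 \<omega>)) - H Y1 \<le> 1 + err * log 2 M1"
    using mult_right_mono[OF err1 log0(1)] by linarith
  have "H (\<lambda>\<omega>. (W2 \<omega>, Y2 \<omega>)) \<le> H Y2 + 1 + measure p {\<omega>. dec2 c (Y2 \<omega>) \<noteq> W2 \<omega>} * log 2 M2"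
    using fano[OF fin _ range(2), of Y2 "dec2 c"] by simp
  then have F2: "H (\<lambda>\<omega>. (W2 \<omega>, Y2 \<omega>)) - H Y2 \<le> 1 + err * log 2 M2"
    using mult_right_mono[OF err2 log0(2)] by linarith
  have "map_pmf W1 p = pmf_of_set {0..<M1}" "map_pmf W2 p = pmf_of_set {0..<M2}"
    by (simp_all add: p_def R_def map_pmf_comp g1_def g2_def case_prod_unfold
        map_pmf_comp[of fst fst, symmetric, unfolded o_def] map_pmf_comp[of fst snd, symmetric, unfolded o_def]
        map_fst_pair_pmf map_snd_pair_pmf)
  then have H: "H W1 = log 2 M1" "H W2 = log 2 M2"
    using ent_uniform nonempty by fastforce+
  show "log 2 M1 \<le> N * m + (1 + err * log 2 M1)"
    using rate1_bound F1 H by linarith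
  show "log 2 M2 \<le> leak + (1 + err * log 2 M2) + real N * real (m - (n - m))"
    using rate2_bound F2 H leak by linarith
  show "log 2 M1 + log 2 M2 \<le> leak + (1 + err * log 2 M1) + (1 + err * log 2 M2)
       + real N * real (m + (m - n) + C)"
    using sum_rate_bound F1 F2 H leak by linarith
qed

text \<open>Truncated subtraction on the naturals supplies the positive parts.\<close>

definition rate_region :: "nat \<Rightarrow> nat \<Rightarrow> nat \<Rightarrow> (real \<times> real) set" where
  "rate_region m n C = {(R1, R2). 0 \<le> R1 \<and> 0 \<le> R2 \<and> R1 \<le> m \<and> R2 \<le> real (m - (n - m)) \<and>
     R1 + R2 \<le> real (m + (m - n) + C)}"

lemma closed_rate_region: "closed (rate_region m n C)"
proof -
  have "rate_region m n C = {R. 0 \<le> fst R} \<inter> {R. 0 \<le> snd R} \<inter> {R. fst R \<le> real m} \<inter>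
      {R. snd R \<le> real (m - (n - m))} \<inter> {R. fst R + snd R \<le> real (m + (m - n) + C)}"
    by (auto simp: rate_region_def)
  then show ?thesis by (auto intro!: closed_Int closed_Collect_le continuous_intros)
qed

text \<open>The power is at least 1, so rounding down loses at most a factor 2, that is one
  bit.\<close>

lemma msg_size_bounds:
  assumes "0 \<le> R"
  shows "1 \<le> msg_size N R" "real N * R - 1 \<le> log 2 (msg_size N R)"
    "real (msg_size N R) \<le> 2 powr (real N * R)" "log 2 (msg_size N R) \<le> real N * R"
proof -
  let ?x = "2 powr (real N * R)"
  have x: "1 \<le> ?x" using assms by (intro ge_one_powr_ge_zero) auto
  have r: "real (msg_size N R) = of_int \<lfloor>?x\<rfloor>" using x by (simp add: msg_size_def)
  have "1 \<le> \<lfloor>?x\<rfloor>" using x by simp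
  then show M: "1 \<le> msg_size N R" unfolding msg_size_def by linarith
  show le: "real (msg_size N R) \<le> ?x" unfolding r by simp
  have "?x \<le> 2 * real (msg_size N R)"
    using M real_of_int_floor_add_one_gt[of ?x] unfolding r[symmetric] by linarith
  then have "log 2 ?x \<le> log 2 (2 * real (msg_size N R))" using x by (intro log_mono) auto
  then show "real N * R - 1 \<le> log 2 (msg_size N R)" using M by (simp add: log_mult)
  have "log 2 (msg_size N R) \<le> log 2 ?x" using M le by (intro log_mono) auto
  then show "log 2 (msg_size N R) \<le> real N * R" by simp
qed

lemma weak_subset_rate_region:
  assumes "achievable Weak m n C R"
  shows "R \<in> rate_region m n C"
proof -
  obtain R1 R2 where R: "R = (R1, R2)" by fastforce
  obtain cs where nonneg: "0 \<le> R1" "0 \<le> R2" and valid: "\<And>N. valid_code C (cs N)"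
    and err: "(\<lambda>N. error_prob m n N (msg_size N R1) (msg_size N R2) (cs N)) \<longlonglongrightarrow> 0"
    and leak: "(\<lambda>N. leak21 m n N R1 R2 (cs N) / real N) \<longlonglongrightarrow> 0"
    using assms by (auto simp: achievable_def R secrecy_ok_def)
  define e where "e N = error_prob m n N (msg_size N R1) (msg_size N R2) (cs N)" for N
  define l where "l N = leak21 m n N R1 R2 (cs N)" for N
  have e: "e \<longlonglongrightarrow> 0" using err by (simp add: e_def[abs_def])
  have l: "(\<lambda>N. l N / real N) \<longlonglongrightarrow> 0" using leak by (simp add: l_def)
  have e0: "0 \<le> e N" for N by (simp add: e_def error_prob_def)
  \<comment> \<open>Divide by \<open>N\<close> and let it grow: the leakage rate, the constant and
    the error term of Fano's inequality all vanish.\<close>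
  have limit: "a \<le> b" if "\<And>N. real N * a \<le> real N * b + l N + k + e N * (real N * d)" for a b k d
  proof -
    have "(\<lambda>N. b + l N / real N + k / real N + e N * d) \<longlonglongrightarrow> b + 0 + 0 + 0 * d"
      by (intro tendsto_intros e l lim_const_over_n)
    moreover have "\<forall>\<^sub>F N in sequentially. a \<le> b + l N / real N + k / real N + e N * d"
      using eventually_gt_at_top[of 0]
    proof eventually_elim
      case (elim N)
      then show ?case using that[of N] by (simp add: field_simps)
    qed
    ultimately show "a \<le> b" using tendsto_lowerbound[OF _ _ sequentially_bot] by fastforce
  qed
  \<comment> \<open>The same without leakage, for the bound on \<open>R1\<close>.\<close>
  have limit': "a \<le> b" if "\<And>N. real N * a \<le> real N * b + k + e N * (real N * d)" for a b k d
  proof -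
    have "(\<lambda>N. b + k / real N + e N * d) \<longlonglongrightarrow> b + 0 + 0 * d"
      by (intro tendsto_intros e lim_const_over_n)
    moreover have "\<forall>\<^sub>F N in sequentially. a \<le> b + k / real N + e N * d"
      using eventually_gt_at_top[of 0]
    proof eventually_elim
      case (elim N)
      then show ?case using that[of N] by (simp add: field_simps)
    qed
    ultimately show "a \<le> b" using tendsto_lowerbound[OF _ _ sequentially_bot] by fastforce
  qed
  \<comment> \<open>Each message pays one bit for rounding its size and one for Fano's inequality,
    whence 2, 2 and 4.\<close>
  have c: "real N * R1 \<le> real N * m + 2 + e N * (real N * R1)"
    "real N * R2 \<le> real N * real (m - (n - m)) + l N + 2 + e N * (real N * R2)"
    "real N * (R1 + R2) \<le> real N * real (m + (m - n) + C) + l N + 4 + e N * (real N * (R1 + R2))" for N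
  proof -
    note conv = code_converse[OF valid[of N] msg_size_bounds(1)[OF nonneg(1), of N]
        msg_size_bounds(1)[OF nonneg(2), of N], where m = m and n = n and N = N, folded leak21_def e_def l_def]
    note b1 = msg_size_bounds[OF nonneg(1), of N] and b2 = msg_size_bounds[OF nonneg(2), of N]
    note m1 = mult_left_mono[OF b1(4) e0[of N]] and m2 = mult_left_mono[OF b2(4) e0[of N]]
    show "real N * R1 \<le> real N * m + 2 + e N * (real N * R1)"
      using conv(1) b1(2) m1 by simp
    show "real N * R2 \<le> real N * real (m - (n - m)) + l N + 2 + e N * (real N * R2)"
      using conv(2) b2(2) m2 by simp
    show "real N * (R1 + R2) \<le> real N * real (m + (m - n) + C) + l N + 4 + e N * (real N * (R1 + R2))"
      using conv(3) b1(2) m1 b2(2) m2 by (simp add: distrib_left)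
  qed
  have "R1 \<le> m" using c(1) by (rule limit')
  moreover have "R2 \<le> real (m - (n - m))" using c(2) by (rule limit)
  moreover have "R1 + R2 \<le> real (m + (m - n) + C)" using c(3) by (rule limit)
  ultimately show ?thesis using nonneg by (simp add: rate_region_def R)
qed

section \<open>Cancellation and jamming\<close>

definition xor_set :: "'a set \<Rightarrow> 'a set \<Rightarrow> 'a set" where
  "xor_set A B = {z. (z \<in> A) \<noteq> (z \<in> B)}"

text \<open>Adding a fixed mask is an involution of \<open>Pow J\<close>, and a bijection preserves
  the uniform law.\<close>

lemma map_xor_set_uniform:
  assumes "finite J" "s \<subseteq> J"
  shows "map_pmf (\<lambda>K. xor_set K s) (pmf_of_set (Pow J)) = pmf_of_set (Pow J)"
proof -
  have inv: "xor_set (xor_set K s) s = K" for K by (auto simp: xor_set_def)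
  have "xor_set K s \<in> Pow J" if "K \<in> Pow J" for K using that assms(2) by (auto simp: xor_set_def)
  then have bij: "bij_betw (\<lambda>K. xor_set K s) (Pow J) (Pow J)"
    by (intro bij_betwI[where g = "\<lambda>K. xor_set K s"]) (auto simp: inv)
  then show ?thesis
    using map_pmf_of_set_bij_betw[OF bij] assms(1) by auto
qed

text \<open>\<open>out2\<close> is a function of \<open>w2\<close> and \<open>r2\<close>, so the
  zeros in \<open>?Y\<close> are placeholders and the joint law is a product.\<close>

lemma mutual_info_W1_out2: "mutual_info (code_space M1 M2 c) msgW1 (out2 m n N c) = 0"
proof (rule mutual_info_eq_0)
  let ?Y = "\<lambda>(w2, r2). out2 m n N c (0, w2, 0, r2)"
  let ?A = "pair_pmf (pmf_of_set {0..<M1}) (rnd1 c)" and ?B = "pair_pmf (pmf_of_set {0..<M2}) (rnd2 c)"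
  have "map_pmf (\<lambda>\<omega>. (msgW1 \<omega>, out2 m n N c \<omega>)) (code_space M1 M2 c) =
      map_pmf (\<lambda>(u, v). (fst u, ?Y v)) (pair_pmf ?A ?B)"
    unfolding code_space_eq map_pmf_comp by (intro map_pmf_cong) (auto simp: msgW1_def out2_def)
  also have "\<dots> = pair_pmf (map_pmf fst ?A) (map_pmf ?Y ?B)" by (rule map_pair)
  finally show "map_pmf (\<lambda>\<omega>. (msgW1 \<omega>, out2 m n N c \<omega>)) (code_space M1 M2 c) =
      pair_pmf (map_pmf fst ?A) (map_pmf ?Y ?B)" .
qed

text \<open>Here \<open>s w2\<close> is the trace of message 2 in the output and
  \<open>\<psi> r1\<close> the key. For fixed messages the masked trace is uniform on
  \<open>Pow J\<close>, so the conditional law of the output is free of \<open>w2\<close>.\<close>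

lemma mutual_info_one_time_pad:
  assumes J: "finite J" and s: "\<And>w. s w \<subseteq> J"
    and key: "map_pmf \<psi> (rnd1 c) = pmf_of_set (Pow J)"
    and out: "\<And>w1 w2 r1 r2. out1 m n N c (w1, w2, r1, r2) = G w1 (xor_set (\<psi> r1) (s w2))"
  shows "mutual_info (code_space M1 M2 c) msgW2 (out1 m n N c) = 0"
proof (rule mutual_info_eq_0)
  let ?U1 = "pmf_of_set {0..<M1}" and ?U2 = "pmf_of_set {0..<M2}" and ?K = "pmf_of_set (Pow J)"
  let ?B = "bind_pmf ?U1 (\<lambda>w1. map_pmf (G w1) ?K)"
  have "map_pmf (\<lambda>r1. (w2, G w1 (xor_set (\<psi> r1) (s w2)))) (rnd1 c) = map_pmf (\<lambda>K. (w2, G w1 K)) ?K" for w1 w2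
  proof -
    have "map_pmf (\<lambda>r1. (w2, G w1 (xor_set (\<psi> r1) (s w2)))) (rnd1 c) =
        map_pmf (\<lambda>K. (w2, G w1 K)) (map_pmf (\<lambda>K. xor_set K (s w2)) (map_pmf \<psi> (rnd1 c)))"
      by (simp only: map_pmf_comp)
    then show ?thesis by (simp only: key map_xor_set_uniform[OF J s])
  qed
  note pad = this
  have "map_pmf (\<lambda>\<omega>. (msgW2 \<omega>, out1 m n N c \<omega>)) (code_space M1 M2 c) =
      bind_pmf ?U1 (\<lambda>w1. bind_pmf ?U2 (\<lambda>w2. map_pmf (\<lambda>r1. (w2, G w1 (xor_set (\<psi> r1) (s w2)))) (rnd1 c)))"
    unfolding code_space_def
    by (simp add: map_bind_pmf msgW2_def out bind_pmf_const map_pmf_def[of _ "rnd1 c"])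
  also have "\<dots> = bind_pmf ?U2 (\<lambda>w2. bind_pmf ?U1 (\<lambda>w1. map_pmf (\<lambda>K. (w2, G w1 K)) ?K))"
    unfolding pad by (rule bind_commute_pmf)
  also have "\<dots> = pair_pmf ?U2 ?B"
    unfolding pair_pmf_def by (simp add: map_pmf_def bind_assoc_pmf bind_return_pmf)
  finally show "map_pmf (\<lambda>\<omega>. (msgW2 \<omega>, out1 m n N c \<omega>)) (code_space M1 M2 c) = pair_pmf ?U2 ?B" .
qed

text \<open>A pair \<open>(t, j)\<close> stands for level \<open>j\<close> of an input at time \<open>t\<close>. Level \<open>j\<close> of the second input
  meets level \<^term>\<open>j + m - n\<close> of the first one at receiver 1. Transmitter 2 uses the levels below
  \<^term>\<open>(n - m) + c0\<close> (these are sent over the link one time step ahead, and cancelled by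
  transmitter 1), the positions \<open>J\<close> (jammed by transmitter 1), and the levels from \<open>n\<close> on, which
  receiver 1 does not see.\<close>

definition jam :: "nat \<Rightarrow> nat \<Rightarrow> (nat \<times> nat) set \<Rightarrow> (nat \<times> nat) set" where
  "jam m n J = (\<lambda>(t, j). (t, j + m - n)) ` J"

definition data1 :: "nat \<Rightarrow> nat \<Rightarrow> nat \<Rightarrow> (nat \<times> nat) set \<Rightarrow> (nat \<times> nat) set" where
  "data1 m n N J = {1..<N} \<times> {..<m} - jam m n J"

text \<open>The top \<open>n - m\<close> levels stay empty because receiver 1 would read them in the
  clear, and time 0 stays empty because no link symbol has arrived by then.\<close>

definition data2 :: "nat \<Rightarrow> nat \<Rightarrow> nat \<Rightarrow> nat \<Rightarrow> (nat \<times> nat) set \<Rightarrow> (nat \<times> nat) set" where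
  "data2 m n N c0 J = {1..<N} \<times> {n - m..<n - m + c0} \<union> J \<union> {1..<N} \<times> {n..<m}"

definition read_levels :: "nat \<Rightarrow> nat \<Rightarrow> (nat \<Rightarrow> nat \<Rightarrow> bool) \<Rightarrow> (nat \<times> nat) set" where
  "read_levels m n y = {(t, i). y t (i + (qdim m n - m))}"

lemma read_block_y2: "read_levels m n (block_y2 m n N S) = S \<inter> {..<N} \<times> {..<m}"
  by (auto simp: read_levels_def block_y2_def qdim_def)

text \<open>\<open>\<phi>1\<close> and \<open>\<phi>2\<close> are the codebooks,
  \<open>\<psi>\<close> turns random numbers into jamming sets, \<open>\<theta>\<close> turns link
  symbols into sets of announced levels. Injectivity of the codebooks is assumed only in
  \<open>no_error\<close>: validity and secrecy must hold at every block length, decodability only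
  eventually.\<close>

locale zic_scheme =
  fixes m n C N c0 M1 M2 :: nat and J :: "(nat \<times> nat) set" and \<phi>1 \<phi>2 \<psi> :: "nat \<Rightarrow> (nat \<times> nat) set"
    and \<theta> :: "nat \<Rightarrow> nat set"
  assumes M: "1 \<le> M1" "1 \<le> M2"
    and c0: "c0 \<le> C" "c0 \<le> min m n - (n - m)"
    and J: "J \<subseteq> {1..<N} \<times> {n - m + c0..<min m n}"
    and \<phi>1: "\<phi>1 w \<subseteq> data1 m n N J"
    and \<phi>2: "\<phi>2 w \<subseteq> data2 m n N c0 J"
    and \<psi>: "bij_betw \<psi> {0..<2 ^ card (jam m n J)} (Pow (jam m n J))"
    and \<theta>: "bij_betw \<theta> {0..<2 ^ c0} (Pow {n - m..<n - m + c0})"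
begin

definition link where
  "link w t = {j. (Suc t, j) \<in> \<phi>2 w \<and> j \<in> {n - m..<n - m + c0}}"

text \<open>The first input is the sum of data, jamming and the bits announced one step earlier. Its
  level \<open>i\<close> collides with level \<open>i + n - m\<close> of the second input;
  \<open>m \<le> i + n\<close> and \<open>0 < t\<close> guard the truncated subtractions. Receiver 1
  discards the jammed positions before decoding.\<close>

definition code :: code where
  "code = \<lparr> rnd1 = pmf_of_set {0..<2 ^ card (jam m n J)}, rnd2 = return_pmf 0,
     enc1 = (\<lambda>w r v t i. ((t, i) \<in> \<phi>1 w) \<noteq> (((t, i) \<in> \<psi> r) \<noteq> (0 < t \<and> m \<le> i + n \<and> i + n - m \<in> \<theta> (v (t - 1))))),
     enc2 = (\<lambda>w r t j. (t, j) \<in> \<phi>2 w),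
     coop = (\<lambda>w r t. inv_into {0..<2 ^ c0} \<theta> (link w t)),
     dec1 = (\<lambda>y. inv_into {0..<M1} \<phi>1 (read_levels m n y - jam m n J)),
     dec2 = (\<lambda>y. inv_into {0..<M2} \<phi>2 (read_levels m n y)) \<rparr>"

lemma link_Pow: "link w t \<in> Pow {n - m..<n - m + c0}"
  by (auto simp: link_def)

lemma \<theta>_coop: "\<theta> (coop code w r t) = link w t"
  using bij_betw_inv_into_right[OF \<theta> link_Pow] by (simp add: code_def)

lemma valid_code: "valid_code C code"
  unfolding valid_code_def
proof (intro conjI allI impI)
  fix w r t
  have "coop code w r t \<in> {0..<2 ^ c0}"
    using bij_betw_apply[OF bij_betw_inv_into[OF \<theta>] link_Pow] by (simp add: code_def)
  then have "coop code w r t < 2 ^ c0" by simp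
  also have "\<dots> \<le> 2 ^ C" using c0(1) by (intro power_increasing) auto
  finally show "coop code w r t < 2 ^ C" .
next
  fix w r t and v v' :: "nat \<Rightarrow> nat" assume "\<forall>s<t. v s = v' s"
  then show "enc1 code w r v t = enc1 code w r v' t"
    by (cases t) (auto simp: code_def)
qed

text \<open>The interference left after cancellation, in the coordinates of the first input: the
  plaintext that the jamming has to hide.\<close>

definition pad where
  "pad w = {(t, i). i < m \<and> m \<le> i + n \<and> (t, i + n - m) \<in> \<phi>2 w \<inter> J}"

lemma pad_subset: "pad w \<subseteq> jam m n J"
proof
  fix z assume "z \<in> pad w"
  then obtain t i where z: "z = (t, i)" "m \<le> i + n" "(t, i + n - m) \<in> J" by (auto simp: pad_def)
  then have "z = (\<lambda>(t, j). (t, j + m - n)) (t, i + n - m)" by simp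
  then show "z \<in> jam m n J" unfolding jam_def using z(3) by blast
qed

lemma jam_subset: "jam m n J \<subseteq> {1..<N} \<times> {..<m}"
proof -
  have "1 \<le> t \<and> t < N \<and> j + m - n < m" if "(t, j) \<in> J" for t j
    using subsetD[OF J that] by auto
  then show ?thesis unfolding jam_def by fastforce
qed

lemma finite_jam: "finite (jam m n J)"
  using jam_subset by (rule finite_subset) auto

lemma \<phi>2_levels: "(t, j) \<in> \<phi>2 w \<Longrightarrow> 0 < t \<and> t < N \<and> n - m \<le> j \<and> j < m"
  using \<phi>2[of w] J c0(2) by (fastforce simp: data2_def)

lemma out2: "out2 m n N code (w1, w2, r1, r2) = block_y2 m n N (\<phi>2 w2)"
  unfolding out2_eq
  by (rule block_y2_cong) (auto simp: input_set_def code_def qdim_def)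

text \<open>With the announced levels cancelled, receiver 1 sees data, jamming and residual
  interference at the levels of the first input; \<open>block_y2\<close> serves as the
  interference-free channel for this combined block.\<close>

lemma out1: "out1 m n N code (w1, w2, r1, r2) =
    block_y2 m n N (xor_set (\<phi>1 w1) (xor_set (\<psi> r1) (pad w2)))" (is "_ = block_y2 m n N ?Z")
proof -
  define X1 where "X1 = input_set N m (enc1 code w1 r1 (coop code w2 r2))"
  have X1: "((t, i) \<in> X1) = (((t, i) \<in> \<phi>1 w1) \<noteq> (((t, i) \<in> \<psi> r1) \<noteq>
      (m \<le> i + n \<and> (t, i + n - m) \<in> \<phi>2 w2 \<and> i + n - m < n - m + c0)))" if "t < N" "i < m" for t i
  proof -
    have "(0 < t \<and> i + n - m \<in> \<theta> (coop code w2 r2 (t - 1))) = ((t, i + n - m) \<in> \<phi>2 w2 \<and> i + n - m < n - m + c0)"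
      unfolding \<theta>_coop link_def using \<phi>2_levels[of t "i + n - m" w2] by auto
    then show ?thesis using that unfolding X1_def input_set_def by (simp add: code_def) blast
  qed
  have Z: "((t, i) \<in> ?Z) = (((t, i) \<in> \<phi>1 w1) \<noteq> (((t, i) \<in> \<psi> r1) \<noteq>
      (m \<le> i + n \<and> (t, i + n - m) \<in> \<phi>2 w2 \<and> (t, i + n - m) \<in> J)))" if "i < m" for t i
    using that by (auto simp: xor_set_def pad_def)
  \<comment> \<open>Each occupied level of the second input that collides with the first one is
    either jammed or announced, never both.\<close>
  have cancel: "((t, i + n - m) \<in> J) = (\<not> i + n - m < n - m + c0)"
    if "(t, i + n - m) \<in> \<phi>2 w2" "i < m" "m \<le> i + n" for t i
  proof -
    have "i + n - m < n" using that by linarith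
    then show ?thesis using that(1) \<phi>2[of w2] J by (auto simp: data2_def)
  qed
  have main: "((t, i) \<in> X1) \<noteq> (m \<le> i + n \<and> (t, i + n - m) \<in> \<phi>2 w2) \<longleftrightarrow> (t, i) \<in> ?Z"
    if "t < N" "i < m" for t i
    unfolding X1[OF that] Z[OF that(2)] using cancel[of t i] that by blast
  have "out1 m n N code (w1, w2, r1, r2) = block_y1 m n N X1 (\<phi>2 w2)"
    unfolding out1_eq X1_def by (rule block_y1_cong) (auto simp: input_set_def code_def qdim_def)
  also have "\<dots> = block_y2 m n N ?Z"
  proof (intro ext)
    fix t l
    show "block_y1 m n N X1 (\<phi>2 w2) t l = block_y2 m n N ?Z t l"
    proof (cases "t < N \<and> l < qdim m n")
      case True
      show ?thesis
      proof (cases "qdim m n - m \<le> l")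
        case ge: True
        define i where "i = l - (qdim m n - m)"
        have "i < m" using True ge by (auto simp: i_def qdim_def)
        moreover have "qdim m n - n \<le> l \<longleftrightarrow> m \<le> i + n" using ge by (auto simp: i_def qdim_def)
        moreover have "l - (qdim m n - n) = i + n - m" if "m \<le> i + n" using that ge by (auto simp: i_def qdim_def)
        ultimately show ?thesis
          using main[of t i] True ge unfolding block_y1_def block_y2_def i_def[symmetric] by auto
      next
        case False
        \<comment> \<open>These output levels lie above the reach of transmitter 1, and transmitter
          2 leaves them empty.\<close>
        then have "qdim m n = n" "l < n - m" by (auto simp: qdim_def max_def split: if_splits)
        moreover have "(t, l) \<notin> \<phi>2 w2" using \<phi>2_levels[of t l w2] \<open>l < n - m\<close> by auto
        ultimately show ?thesis using False by (simp add: block_y1_def block_y2_def)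
      qed
    qed (auto simp: block_y1_def block_y2_def)
  qed
  finally show ?thesis .
qed

lemma secret: "mutual_info (code_space M1 M2 code) msgW2 (out1 m n N code) = 0"
proof (rule mutual_info_one_time_pad[OF finite_jam pad_subset])
  show "map_pmf \<psi> (rnd1 code) = pmf_of_set (Pow (jam m n J))"
    using map_pmf_of_set_bij_betw[OF \<psi>] by (simp add: code_def)
  show "out1 m n N code (w1, w2, r1, r2) =
      (\<lambda>w K. block_y2 m n N (xor_set (\<phi>1 w) K)) w1 (xor_set (\<psi> r1) (pad w2))" for w1 w2 r1 r2
    by (simp add: out1)
qed

text \<open>Jamming and residual interference are confined to \<open>jam m n J\<close>, which
  \<open>data1\<close> avoids, so deleting these positions leaves exactly
  \<open>\<phi>1 w1\<close>.\<close>

lemma no_error: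
  assumes "inj_on \<phi>1 {0..<M1}" "inj_on \<phi>2 {0..<M2}"
  shows "error_prob m n N M1 M2 code = 0"
proof -
  have "dec1 code (out1 m n N code \<omega>) = msgW1 \<omega> \<and> dec2 code (out2 m n N code \<omega>) = msgW2 \<omega>"
    if "\<omega> \<in> set_pmf (code_space M1 M2 code)" for \<omega>
  proof -
    have ne: "{0..<M1} \<noteq> {}" "{0..<M2} \<noteq> {}" "{0..<(2::nat) ^ card (jam m n J)} \<noteq> {}" using M by auto
    obtain w1 w2 r1 r2 where \<omega>: "\<omega> = (w1, w2, r1, r2)" by (cases \<omega>)
    then have w: "w1 \<in> {0..<M1}" "w2 \<in> {0..<M2}" "r1 \<in> {0..<2 ^ card (jam m n J)}"
      using that ne by (auto simp: code_space_def code_def)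
    have "\<psi> r1 \<subseteq> jam m n J" using bij_betw_apply[OF \<psi> w(3)] by simp
    then have "xor_set (\<phi>1 w1) (xor_set (\<psi> r1) (pad w2)) \<inter> {..<N} \<times> {..<m} - jam m n J = \<phi>1 w1"
      using pad_subset[of w2] \<phi>1[of w1] by (fastforce simp: xor_set_def data1_def)
    moreover have "\<phi>2 w2 \<inter> {..<N} \<times> {..<m} = \<phi>2 w2" using \<phi>2_levels by fastforce
    ultimately show ?thesis
      using inv_into_f_f[OF assms(1) w(1)] inv_into_f_f[OF assms(2) w(2)]
      by (simp add: \<omega> msgW1_def msgW2_def out1 out2) (simp add: code_def read_block_y2)
  qed
  then show ?thesis unfolding error_prob_def by (auto simp: measure_pmf_zero_iff)
qed

end

section \<open>Existence of perfectly secret codes for given message sizes\<close>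

lemma ex_subset_coding:
  assumes "finite P"
  shows "\<exists>\<phi> :: nat \<Rightarrow> 'a set. (\<forall>w. \<phi> w \<subseteq> P) \<and> (M \<le> 2 ^ card P \<longrightarrow> inj_on \<phi> {0..<M})"
proof (cases "M \<le> 2 ^ card P")
  case True
  then have "card {0..<M} \<le> card (Pow P)" using assms by (simp add: card_Pow)
  then obtain f where f: "f ` {0..<M} \<subseteq> Pow P" "inj_on f {0..<M}"
    using card_le_inj[of "{0..<M}" "Pow P"] assms by auto
  define \<phi> where "\<phi> w = (if w < M then f w else {})" for w
  have "inj_on \<phi> {0..<M}" using f(2) by (auto simp: \<phi>_def inj_on_def)
  moreover have "\<phi> w \<subseteq> P" for w using f(1) by (simp add: \<phi>_def image_subset_iff)
  ultimately show ?thesis by blast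
next
  case False
  \<comment> \<open>With too many messages a codebook must still exist, so a constant one is
    taken.\<close>
  then show ?thesis by (intro exI[of _ "\<lambda>_. {}"]) auto
qed

lemma ex_bij_Pow:
  assumes "finite P"
  shows "\<exists>f :: nat \<Rightarrow> 'a set. bij_betw f {0..<2 ^ card P} (Pow P)"
  using assms by (intro finite_same_card_bij) (auto simp: card_Pow)

text \<open>Each of the \<open>g\<close> jammed positions moves one bit from message 1 to message 2.
  The bound on \<open>g\<close> counts the positions of the interfering levels that are neither
  cancelled nor visible in the clear, over the \<open>N - 1\<close> times in use.\<close>

lemma ex_perfect_code:
  fixes m n C N g M1 M2 :: nat
  defines "c0 \<equiv> min C (min m n - (n - m))"
  assumes M: "1 \<le> M1" "1 \<le> M2" and g: "g \<le> (N - 1) * (min m n - (n - m) - c0)"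
  shows "\<exists>c. valid_code C c \<and> mutual_info (code_space M1 M2 c) msgW2 (out1 m n N c) = 0 \<and>
    (M1 \<le> 2 ^ ((N - 1) * m - g) \<longrightarrow> M2 \<le> 2 ^ ((N - 1) * (c0 + (m - n)) + g) \<longrightarrow>
      error_prob m n N M1 M2 c = 0)"
proof -
  let ?A = "{1..<N} \<times> {n - m + c0..<min m n}"
  have "card ?A = (N - 1) * (min m n - (n - m) - c0)" by (simp add: card_cartesian_product)
  then obtain J where J: "J \<subseteq> ?A" "card J = g"
    using g obtain_subset_with_card_n[of g ?A] by auto
  have finJ: "finite J" using J(1) by (rule finite_subset) auto
  have lev: "0 < t \<and> t < N \<and> n \<le> j + m \<and> j < n" if "(t, j) \<in> J" for t j
    using subsetD[OF J(1) that] by auto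
  \<comment> \<open>Injective because \<open>n \<le> j + m\<close> on \<open>J\<close> keeps the
    subtraction from truncating.\<close>
  have "inj_on (\<lambda>(t, j). (t, j + m - n)) J" by (auto simp: inj_on_def dest!: lev)
  then have cj: "card (jam m n J) = g" using J(2) by (simp add: jam_def card_image)
  have "jam m n J \<subseteq> {1..<N} \<times> {..<m}" by (auto simp: jam_def dest!: lev)
  then have c1: "card (data1 m n N J) = (N - 1) * m - g"
    unfolding data1_def using finite_subset[of "jam m n J" "{1..<N} \<times> {..<m}"]
    by (simp add: card_Diff_subset cj card_cartesian_product)
  have "card (data2 m n N c0 J) = (N - 1) * (c0 + (m - n)) + g"
  proof -
    have le: "c0 \<le> min m n - (n - m)" by (simp add: c0_def)
    have 1: "({1..<N} \<times> {n - m..<n - m + c0} \<union> J) \<inter> {1..<N} \<times> {n..<m} = {}"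
      using J(1) le by fastforce
    have 2: "{1..<N} \<times> {n - m..<n - m + c0} \<inter> J = {}" using J(1) by fastforce
    show ?thesis unfolding data2_def
      using card_Un_disjoint[OF _ _ 1] card_Un_disjoint[OF _ _ 2] finJ J(2)
      by (simp add: card_cartesian_product distrib_left)
  qed
  note c2 = this
  obtain \<phi>1 where \<phi>1: "\<forall>w. \<phi>1 w \<subseteq> data1 m n N J" "M1 \<le> 2 ^ card (data1 m n N J) \<longrightarrow> inj_on \<phi>1 {0..<M1}"
    using ex_subset_coding[of "data1 m n N J" M1] by (auto simp: data1_def)
  obtain \<phi>2 where \<phi>2: "\<forall>w. \<phi>2 w \<subseteq> data2 m n N c0 J" "M2 \<le> 2 ^ card (data2 m n N c0 J) \<longrightarrow> inj_on \<phi>2 {0..<M2}"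
    using ex_subset_coding[of "data2 m n N c0 J" M2] finJ by (auto simp: data2_def)
  obtain \<psi> :: "nat \<Rightarrow> (nat \<times> nat) set" where \<psi>: "bij_betw \<psi> {0..<2 ^ card (jam m n J)} (Pow (jam m n J))"
    using ex_bij_Pow[of "jam m n J"] finJ by (auto simp: jam_def)
  obtain \<theta> :: "nat \<Rightarrow> nat set" where "bij_betw \<theta> {0..<2 ^ card {n - m..<n - m + c0}} (Pow {n - m..<n - m + c0})"
    using ex_bij_Pow[of "{n - m..<n - m + c0}"] by blast
  moreover note inj = \<phi>1(2) \<phi>2(2)
  ultimately interpret zic_scheme m n C N c0 M1 M2 J \<phi>1 \<phi>2 \<psi> \<theta>
    using M J(1) \<phi>1(1) \<phi>2(1) \<psi> by unfold_locales (auto simp: c0_def)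
  show ?thesis using valid_code secret no_error inj c1 c2 by metis
qed

section \<open>Inner bound\<close>

lemma msg_size_le_power:
  assumes "0 \<le> R" "real N * R \<le> real k"
  shows "msg_size N R \<le> 2 ^ k"
proof -
  have "real (msg_size N R) \<le> 2 powr (real N * R)" by (rule msg_size_bounds(3)[OF assms(1)])
  also have "\<dots> \<le> 2 powr real k" using assms(2) by (intro powr_mono) auto
  also have "\<dots> = real (2 ^ k)" by (simp add: powr_realpow)
  finally show ?thesis by (simp only: of_nat_le_iff)
qed

text \<open>Any number \<open>g\<close> of jammed positions is possible up to the stated limit; \<open>g\<close> is the excess of
  the bits of message 2 over the free and cancelled positions. The factor \<open>r < 1\<close> pays for the
  unused first time step and for rounding.\<close>

lemma achievable_scaled:
  assumes m: "1 \<le> m" and R: "(R1, R2) \<in> rate_region m n C" and r: "0 \<le> r" "r < 1"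
  shows "achievable Perfect m n C (r * R1, r * R2)"
proof -
  define A where "A = min m n - (n - m)"
  define c0 where "c0 = min C A"
  define F where "F = m - n"
  define S where "S = m + c0 + F"
  have R0: "0 \<le> R1" "0 \<le> R2" and R1: "R1 \<le> m" using R by (auto simp: rate_region_def)
  have "m - (n - m) = A + F" by (auto simp: A_def F_def min_def)
  then have R2: "R2 \<le> real (A + F)" using R by (auto simp: rate_region_def)
  have "R1 + R2 \<le> real (m + F + C)" using R by (auto simp: rate_region_def F_def)
  \<comment> \<open>If \<open>C\<close> exceeds \<open>A\<close>, then \<open>c0 = A\<close> and the
    bound is the sum of the two individual ones.\<close>
  then have sum: "R1 + R2 \<le> S" using R1 R2 by (cases "C \<le> A") (auto simp: S_def c0_def)
  have rR: "0 \<le> r * R1" "0 \<le> r * R2" using r R0 by auto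
  \<comment> \<open>At these block lengths the slack from \<open>r < 1\<close> covers the lost time
    step and one bit of rounding.\<close>
  define good where "good N \<longleftrightarrow> 0 < N \<and> real N * r * S \<le> real (N - 1) * S - 1" for N
  have S: "1 \<le> real S" using m by (simp add: S_def)
  have code: "\<exists>c. valid_code C c \<and>
      mutual_info (code_space (msg_size N (r * R1)) (msg_size N (r * R2)) c) msgW2 (out1 m n N c) = 0 \<and>
      (good N \<longrightarrow> error_prob m n N (msg_size N (r * R1)) (msg_size N (r * R2)) c = 0)" for N
  proof (cases "good N")
    \<comment> \<open>Only validity and secrecy are required here, so a code without jamming will
      do.\<close>
    case False
    then show ?thesis
      using ex_perfect_code[OF msg_size_bounds(1)[OF rR(1), of N] msg_size_bounds(1)[OF rR(2), of N],
          where g = 0 and N = N and C = C and m = m and n = n] by auto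
  next
    case True
    define T where "T = real (N - 1)"
    have N: "real N * r * S \<le> T * S - 1" using True unfolding good_def T_def by blast
    have "real N * r * S \<le> T * S" using N by linarith
    then have Nr: "real N * r \<le> T" using S by simp
    define k where "k = nat \<lceil>real N * (r * R2)\<rceil>"
    define g where "g = k - (N - 1) * (c0 + F)"
    have b0: "0 \<le> real N * (r * R2)" using rR by simp
    have k: "real N * (r * R2) \<le> real k" "real k < real N * (r * R2) + 1"
      using b0 unfolding k_def by linarith+
    have "real N * (r * R2) = (real N * r) * R2" by simp
    also have "\<dots> \<le> T * real (A + F)" using Nr R2 R0 r by (intro mult_mono) (auto simp: T_def)
    also have "\<dots> = real ((N - 1) * (A + F))" by (simp add: T_def)
    finally have "k \<le> (N - 1) * (A + F)" unfolding k_def by linarith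
    moreover have "(N - 1) * (A + F) = (N - 1) * (A - c0) + (N - 1) * (c0 + F)"
      by (simp add: c0_def distrib_left[symmetric])
    ultimately have g: "g \<le> (N - 1) * (A - c0)" unfolding g_def by linarith
    have "real N * (r * R2) \<le> real ((N - 1) * (c0 + F) + g)" using k(1) unfolding g_def by linarith
    then have M2: "msg_size N (r * R2) \<le> 2 ^ ((N - 1) * (c0 + F) + g)" by (rule msg_size_le_power[OF rR(2)])
    have "real N * (r * R1) \<le> real ((N - 1) * m - g)"
    proof (cases "g = 0")
      case True
      have "real N * (r * R1) = (real N * r) * R1" by simp
      also have "\<dots> \<le> T * real m" using Nr R1 R0 r by (intro mult_mono) (auto simp: T_def)
      finally show ?thesis by (simp add: True T_def)
    next
      \<comment> \<open>Now the subtraction defining \<open>g\<close> does not truncate, and the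
        sum-rate bound pays for the jammed positions.\<close>
      case False
      then have gk: "real g = real k - T * real (c0 + F)" unfolding g_def T_def by (simp add: of_nat_diff)
      have "(real N * r) * (R1 + R2) \<le> (real N * r) * S" using sum r by (intro mult_left_mono) auto
      then have "real N * (r * R1) + real N * (r * R2) \<le> T * S - 1" using N by (simp add: algebra_simps)
      moreover have "T * S = T * real m + T * real (c0 + F)" by (simp add: S_def algebra_simps)
      ultimately have "real N * (r * R1) \<le> T * real m - real g" using k(2) gk by linarith
      also have "\<dots> = real ((N - 1) * m) - real g" by (simp add: T_def)
      also have "\<dots> \<le> real ((N - 1) * m - g)" by linarith
      finally show ?thesis .
    qed
    then have M1: "msg_size N (r * R1) \<le> 2 ^ ((N - 1) * m - g)" by (rule msg_size_le_power[OF rR(1)])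
    show ?thesis
      using ex_perfect_code[OF msg_size_bounds(1)[OF rR(1), of N] msg_size_bounds(1)[OF rR(2), of N],
          where g = g and N = N and C = C and m = m and n = n] g M1 M2
      unfolding A_def c0_def F_def by blast
  qed
  then obtain cs where cs: "\<And>N. valid_code C (cs N)"
      "\<And>N. leak21 m n N (r * R1) (r * R2) (cs N) = 0"
      "\<And>N. good N \<Longrightarrow> error_prob m n N (msg_size N (r * R1)) (msg_size N (r * R2)) (cs N) = 0"
    unfolding leak21_def by metis
  \<comment> \<open>For positive \<open>N\<close> the condition rearranges to
    \<open>S + 1 \<le> N * ((1 - r) * S)\<close>, which gives the threshold.\<close>
  have "\<forall>\<^sub>F N in sequentially. good N"
    using eventually_gt_at_top[of 0] eventually_ge_at_top[of "nat \<lceil>(S + 1) / ((1 - r) * S)\<rceil>"]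
  proof eventually_elim
    case (elim N)
    have "(S + 1) / ((1 - r) * S) \<le> real N" using elim(2) by linarith
    then have "real S + 1 \<le> real N * ((1 - r) * S)" using r S by (simp add: divide_le_eq)
    then show ?case using elim(1) by (simp add: good_def of_nat_diff algebra_simps)
  qed
  then have "\<forall>\<^sub>F N in sequentially. error_prob m n N (msg_size N (r * R1)) (msg_size N (r * R2)) (cs N) = 0"
    by eventually_elim (rule cs(3))
  then have "(\<lambda>N. error_prob m n N (msg_size N (r * R1)) (msg_size N (r * R2)) (cs N)) \<longlonglongrightarrow> 0"
    by (rule tendsto_eventually)
  moreover have "secrecy_ok Perfect m n (r * R1) (r * R2) cs"
    by (simp add: secrecy_ok_def cs(2) leak12_def mutual_info_W1_out2)
  ultimately show ?thesis using cs(1) rR unfolding achievable_def by auto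
qed

text \<open>The factors \<open>k / (k + 1)\<close> are below 1 and tend to 1, so the scaled points
  are achievable and converge to the given one.\<close>

lemma rate_region_subset_perfect:
  assumes "1 \<le> m"
  shows "rate_region m n C \<subseteq> capacity_region Perfect m n C"
proof
  fix R assume R: "R \<in> rate_region m n C"
  let ?r = "\<lambda>k. real k / real (Suc k)"
  have "achievable Perfect m n C (?r k * fst R, ?r k * snd R)" for k
    by (rule achievable_scaled[OF assms]) (use R in auto)
  then have mem: "\<forall>k. ?r k *\<^sub>R R \<in> {R. achievable Perfect m n C R}"
    by (simp only: scaleR_prod_def real_scaleR_def mem_Collect_eq) blast
  have "(\<lambda>k. ?r k *\<^sub>R R) \<longlonglongrightarrow> 1 *\<^sub>R R"
    by (intro tendsto_intros LIMSEQ_n_over_Suc_n)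
  then have lim: "(\<lambda>k. ?r k *\<^sub>R R) \<longlonglongrightarrow> R" by (simp only: scaleR_one)
  show "R \<in> capacity_region Perfect m n C"
    unfolding capacity_region_def closure_sequential
    by (rule exI[of _ "\<lambda>k. ?r k *\<^sub>R R"]) (intro conjI mem lim)
qed

section \<open>Comparison of the secrecy notions and equality of the regions\<close>

lemma perfect_imp_strong: "achievable Perfect m n C R \<Longrightarrow> achievable Strong m n C R"
  by (auto simp: achievable_def secrecy_ok_def)

lemma strong_imp_weak:
  assumes "achievable Strong m n C R"
  shows "achievable Weak m n C R"
proof -
  have "(\<lambda>N. f N / real N) \<longlonglongrightarrow> 0" if "f \<longlonglongrightarrow> 0" for f :: "nat \<Rightarrow> real"
    using tendsto_mult[OF that lim_inverse_n] by (simp add: divide_inverse)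
  then have "secrecy_ok Strong m n R1 R2 cs \<Longrightarrow> secrecy_ok Weak m n R1 R2 cs" for R1 R2 cs
    by (simp add: secrecy_ok_def)
  then show ?thesis using assms unfolding achievable_def by blast
qed

theorem theorem4:
  fixes m n C :: nat
  assumes "1 \<le> m"
  shows "capacity_region Perfect m n C = capacity_region Strong m n C \<and>
         capacity_region Strong m n C = capacity_region Weak m n C"
proof -
  have "capacity_region Weak m n C \<subseteq> rate_region m n C"
    unfolding capacity_region_def
    by (intro closure_minimal closed_rate_region) (auto dest: weak_subset_rate_region)
  moreover note rate_region_subset_perfect[OF assms, of n C]
  moreover have "capacity_region Perfect m n C \<subseteq> capacity_region Strong m n C"
    unfolding capacity_region_def by (intro closure_mono) (auto dest: perfect_imp_strong)
  moreover have "capacity_region Strong m n C \<subseteq> capacity_region Weak m n C"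
    unfolding capacity_region_def by (intro closure_mono) (auto dest: strong_imp_weak)
  ultimately show ?thesis by blast
qed

end
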